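(* Let $u,v$ be packed words of length $n$. Then $$\mathbf{N}_u*(\sigma_1^t)_n*\mathbf{N}_v=\sum_{w\in W(u,v)}\ \prod_{i=1}^{\max(u)}c_{m^{(i)}}(t)\ \mathbf{K}_w,$$ where $W(u,v)$ is the set of packed words $w$ of length $n$ which are finer than $u$ and weakly finer than $v$, $m^{(i)}=m(v^{(i)},w^{(i)})$ is the refinement word of the pair $(v^{(i)},w^{(i)})$, $v^{(i)}$ and $w^{(i)}$ being the packed words of the subwords of $v$ and $w$ formed by the letters at the positions of the letter $i$ in $u$, and $c_m(t)$ denotes the $t$-Goldberg coefficient of the packed word $m$.
   Context: $\mathbb{K}$ is a field of characteristic $0$, $t$ an indeterminate. A word over the positive integers is packed if its set of letters is $\{1,\dots,r\}$ for some $r$; then $r=\max(u)$. For a word $w$ over a totally ordered alphabet with distinct letters $b_1<\dots<b_r$, $\mathrm{pack}(w)$ is obtained by replacing each $b_i$ by $i$. A packed word $u=u_1\cdots u_n$ is identified with the set composition of $\{1,\dots,n\}$ whose $i$-th block is $\{j:u_j=i\}$. For packed words of length $n$: $w$ is finer than $u$ if the set composition $u$ is obtained from $w$ by merging some consecutive blocks (equivalently $w_i\le w_j\Rightarrow u_i\le u_j$ for all $i,j$); $w$ is weakly finer than $v$ if $w_i=w_j\Rightarrow v_i=v_j$ for all $i,j$. When $x$ is weakly finer than $v$, the refinement word $m(v,x)$ is the word of length $\max(x)$ whose $i$-th letter is $v_j$ for any $j$ with $x_j=i$. (Example: $m(12113,41223)=2131$.) $\mathbf{WQSym}^*_n$ is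 the $\mathbb{K}$-vector space with basis $\mathbf{N}_u$, $u$ running over packed words of length $n$, with (associative) internal product $\mathbf{N}_u*\mathbf{N}_v=\mathbf{N}_{\mathrm{pack}\binom{u}{v}}$, where $\binom{u}{v}$ is the word of biletters $\binom{u_1}{v_1}\cdots\binom{u_n}{v_n}$, ordered lexicographically with priority to the top letter; scalars are extended to $\mathbb{K}[t]$. The degree $n$ component of $\sigma_1^t$ is $$(\sigma_1^t)_n=\sum_{|u|=n}\binom{t}{\max(u)}\mathbf{N}_u=\sum_{k=1}^n t^kE_n^{[k]},$$ the first sum being over all packed words of length $n$; the second equality defines $E_n^{[k]}$. For a packed word $u$ of length $n$, $\mathbf{K}_u:=\mathbf{N}_u*E_n^{[\max(u)]}$. The $t$-Goldberg coefficients $c_u(t)$, $u$ packed, are the polynomials defined by $(e^{a_1}e^{a_2}\cdots)^t=\sum_u c_u(t)\mathbf{M}_u(A)$, where $a_1,a_2,\dots$ are noncommuting variables, $g=e^{a_1}e^{a_2}\cdots$ is viewed as a formal series of words, $g^t=\sum_{k\ge 0}\binom{t}{k}(g-1)^k$, and $\mathbf{M}_u(A)=\sum_{\mathrm{pack}(w)=u}w$ (so $c_u(t)$ is the coefficient in $g^t$ of any word $w$ with $\mathrm{pack}(w)=u$). *)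

theory Defs
  imports
    "HOL-Library.Poly_Mapping"
    "HOL-Library.Product_Lexorder"
    "HOL-Computational_Algebra.Polynomial"
begin

section \<open>Packed words\<close>

definition packed :: "nat list \<Rightarrow> bool" where
  "packed u \<longleftrightarrow> (\<exists>r. set u = {1..r})"

text \<open>The empty word is packed, with maximum 0.\<close>

definition wmax :: "nat list \<Rightarrow> nat" where
  "wmax u = Max (insert 0 (set u))"

definition packed_words :: "nat \<Rightarrow> nat list set" where
  "packed_words n = {u. packed u \<and> length u = n}"

text \<open>The letter \<open>b\<^sub>i\<close> (the \<open>i\<close>-th smallest letter of \<open>w\<close>) has exactly
  \<open>i\<close> letters of \<open>w\<close> below or equal to it.\<close>

definition pack :: "'b::linorder list \<Rightarrow> nat list" where
  "pack w = map (\<lambda>x. card {y \<in> set w. y \<le> x}) w"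

definition finer :: "nat list \<Rightarrow> nat list \<Rightarrow> bool" where
  "finer w u \<longleftrightarrow> length w = length u \<and>
     (\<forall>i<length u. \<forall>j<length u. w ! i \<le> w ! j \<longrightarrow> u ! i \<le> u ! j)"

definition weakly_finer :: "nat list \<Rightarrow> nat list \<Rightarrow> bool" where
  "weakly_finer w v \<longleftrightarrow> length w = length v \<and>
     (\<forall>i<length v. \<forall>j<length v. w ! i = w ! j \<longrightarrow> v ! i = v ! j)"

definition refinement_word :: "nat list \<Rightarrow> nat list \<Rightarrow> nat list" where
  "refinement_word v x = map (\<lambda>i. v ! (SOME j. j < length x \<and> x ! j = i)) [1..<Suc (wmax x)]"

text \<open>\<open>restrict_word u i v\<close> is \<open>v\<^sup>(\<^sup>i\<^sup>)\<close>: the packed word of the subword of \<open>v\<close> at the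
  positions of the letter \<open>i\<close> in \<open>u\<close>.\<close>

definition restrict_word :: "nat list \<Rightarrow> nat \<Rightarrow> nat list \<Rightarrow> nat list" where
  "restrict_word u i v = pack (nths v {j. j < length u \<and> u ! j = i})"

definition W_set :: "nat list \<Rightarrow> nat list \<Rightarrow> nat list set" where
  "W_set u v = {w. packed w \<and> length w = length u \<and> finer w u \<and> weakly_finer w v}"

lemma packed_pack: "packed (pack w)"
proof -
  define f where "f x = card {y \<in> set w. y \<le> x}" for x
  have smono: "f x < f y" if "x < y" "y \<in> set w" for x y
    unfolding f_def using that by (intro psubset_card_mono psubsetI) (auto dest: order.strict_trans1)
  then have inj: "inj_on f (set w)"
    by (intro inj_onI) (metis less_irrefl linorder_neqE)
  have "f ` set w \<subseteq> {1..card (set w)}"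
  proof
    fix k assume "k \<in> f ` set w"
    then obtain x where x: "x \<in> set w" "k = f x" by auto
    have "f x \<le> card (set w)"
      unfolding f_def by (rule card_mono) auto
    moreover have "f x \<noteq> 0" using x by (auto simp: f_def)
    ultimately show "k \<in> {1..card (set w)}" using x by auto
  qed
  moreover have "card (f ` set w) = card {1..card (set w)}"
    using inj by (simp add: card_image)
  ultimately have "f ` set w = {1..card (set w)}"
    by (intro card_subset_eq) auto
  then show ?thesis
    unfolding packed_def pack_def f_def by auto
qed

lemma wmax_le_length:
  assumes "packed u"
  shows "wmax u \<le> length u"
proof -
  obtain r where r: "set u = {1..r}" using assms by (auto simp: packed_def)
  have "r \<le> length u" using card_length[of u] by (simp add: r)
  moreover have "wmax u \<le> r" using r by (auto simp: wmax_def)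
  ultimately show ?thesis by simp
qed

lemma finite_packed_words: "finite (packed_words n)"
proof (rule finite_subset)
  show "packed_words n \<subseteq> {u. set u \<subseteq> {0..n} \<and> length u = n}"
  proof (intro subsetI CollectI conjI)
    fix u x assume u: "u \<in> packed_words n"
    then show "length u = n" by (simp add: packed_words_def)
    assume "x \<in> set u"
    then have "x \<le> wmax u" by (simp add: wmax_def)
    then show "x \<in> {0..n}" using u wmax_le_length[of u] by (auto simp: packed_words_def)
  qed
  show "finite {u. set u \<subseteq> {0..n} \<and> length u = n}"
    by (rule finite_lists_length_eq) simp
qed

lemma finite_W: "finite (W_set u v)"
  by (rule finite_subset[OF _ finite_packed_words[of "length u"]])
     (auto simp: W_set_def packed_words_def)


section \<open>The internal product\<close>

text \<open>Elements of \<open>WQSym\<^sup>*\<close> over a coefficient ring are finitely supported coefficient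
  functions on words; only words that are packed ever occur in their supports.\<close>

definition basis_N :: "nat list \<Rightarrow> nat list \<Rightarrow>\<^sub>0 'c::comm_ring_1" where
  "basis_N u = Poly_Mapping.single u 1"

definition scale :: "'c::comm_ring_1 \<Rightarrow> (nat list \<Rightarrow>\<^sub>0 'c) \<Rightarrow> (nat list \<Rightarrow>\<^sub>0 'c)" where
  "scale c f = Poly_Mapping.map (\<lambda>x. c * x) f"

text \<open>Bilinear extension of the product of basis elements, which is taken to be 0 in different
  degrees. The order on biletters is the lexicographic order of pairs.\<close>

definition basis_prod :: "nat list \<Rightarrow> nat list \<Rightarrow> nat list \<Rightarrow>\<^sub>0 'c::comm_ring_1" where
  "basis_prod u v = (if length u = length v then basis_N (pack (zip u v)) else 0)"

definition internal_prod ::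
    "(nat list \<Rightarrow>\<^sub>0 'c::comm_ring_1) \<Rightarrow> (nat list \<Rightarrow>\<^sub>0 'c) \<Rightarrow> (nat list \<Rightarrow>\<^sub>0 'c)"
    (infixl \<open>\<star>\<close> 70) where
  "f \<star> g = (\<Sum>u\<in>Poly_Mapping.keys f. \<Sum>v\<in>Poly_Mapping.keys g.
     scale (Poly_Mapping.lookup f u * Poly_Mapping.lookup g v) (basis_prod u v))"

lemma N_prod_N: "length u = length v \<Longrightarrow> basis_N u \<star> basis_N v = basis_N (pack (zip u v))"
  by (simp add: internal_prod_def basis_N_def basis_prod_def scale_def map_single)

definition extend_scalars :: "(nat list \<Rightarrow>\<^sub>0 'a::comm_ring_1) \<Rightarrow> (nat list \<Rightarrow>\<^sub>0 'a poly)" where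
  "extend_scalars f = Poly_Mapping.map (\<lambda>c. [:c:]) f"

text \<open>The polynomial \<open>t choose k\<close>; \<open>(gchoose)\<close> itself is only available over fields.\<close>

definition tbinom :: "nat \<Rightarrow> 'a::field_char_0 poly" where
  "tbinom k = smult (inverse (fact k)) (\<Prod>i<k. [:- of_nat i, 1:])"

lemma poly_tbinom: "poly (tbinom k) x = x gchoose k"
  by (simp add: tbinom_def gbinomial_prod_rev poly_prod atLeast0LessThan field_simps)

definition sigma :: "nat \<Rightarrow> nat list \<Rightarrow>\<^sub>0 'a::field_char_0 poly" where
  "sigma n = (\<Sum>u\<in>packed_words n. scale (tbinom (wmax u)) (basis_N u))"

text \<open>\<open>E_coeff n k\<close> is the coefficient of \<open>t\<^sup>k\<close> in \<open>sigma n\<close>; see \<open>sigma_eq_sum_E\<close>.\<close>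

definition E_coeff :: "nat \<Rightarrow> nat \<Rightarrow> nat list \<Rightarrow>\<^sub>0 'a::field_char_0" where
  "E_coeff n k = Poly_Mapping.map (\<lambda>p. coeff p k) (sigma n)"

definition basis_K :: "nat list \<Rightarrow> nat list \<Rightarrow>\<^sub>0 'a::field_char_0" where
  "basis_K u = basis_N u \<star> E_coeff (length u) (wmax u)"

lemma lookup_sigma:
  "Poly_Mapping.lookup (sigma n) u = (if u \<in> packed_words n then tbinom (wmax u) else 0)"
proof -
  have "Poly_Mapping.lookup (sigma n) u
      = (\<Sum>w\<in>packed_words n. if w = u then tbinom (wmax w) else 0)"
    unfolding sigma_def lookup_sum scale_def basis_N_def
    by (intro sum.cong) (auto simp: map_single lookup_single when_def)
  then show ?thesis using finite_packed_words[of n] by simp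
qed

lemma lookup_E: 
  "Poly_Mapping.lookup (E_coeff n k) u = (if u \<in> packed_words n then coeff (tbinom (wmax u)) k else 0)"
  unfolding E_coeff_def by (simp add: map.rep_eq lookup_sigma when_def)

lemma degree_tbinom: "degree (tbinom k :: 'a::field_char_0 poly) \<le> k"
proof -
  have "degree (\<Prod>i<k. [:- of_nat i, 1:] :: 'a poly) \<le> (\<Sum>i<k. degree [:- of_nat i, 1 :: 'a:])"
    by (rule order.trans[OF degree_prod_sum_le]) auto
  then show ?thesis by (simp add: tbinom_def)
qed

lemma coeff_tbinom_0: "k > 0 \<Longrightarrow> coeff (tbinom k :: 'a::field_char_0 poly) 0 = 0"
  by (auto simp: tbinom_def poly_0_coeff_0[symmetric] poly_prod intro!: prod_zero)

lemma sigma_eq_sum_E: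
  assumes "n > 0"
  shows "sigma n = (\<Sum>k=1..n. scale (monom 1 k) (extend_scalars (E_coeff n k :: _ \<Rightarrow>\<^sub>0 'a::field_char_0)))"
proof (rule poly_mapping_eqI)
  fix u
  have sc: "Poly_Mapping.lookup (scale (monom 1 k) (extend_scalars (E_coeff n k :: _ \<Rightarrow>\<^sub>0 'a))) u
     = monom (Poly_Mapping.lookup (E_coeff n k) u) k" for k
    by (simp add: scale_def extend_scalars_def map.rep_eq when_def smult_monom mult.commute[of "monom _ _"])
  show "Poly_Mapping.lookup (sigma n) u
      = Poly_Mapping.lookup (\<Sum>k=1..n. scale (monom 1 k) (extend_scalars (E_coeff n k :: _ \<Rightarrow>\<^sub>0 'a))) u"
  proof (cases "u \<in> packed_words n")
    case True
    then have len: "length u = n" and pu: "packed u" by (auto simp: packed_words_def)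
    obtain x xs where "u = x # xs" using len assms by (cases u) auto
    moreover have "0 \<notin> set u" using pu by (auto simp: packed_def)
    ultimately have "x \<in> set u" "x > 0" by auto
    moreover have "x \<le> wmax u" using \<open>x \<in> set u\<close> by (simp add: wmax_def)
    ultimately have pos: "wmax u > 0" by linarith
    let ?p = "tbinom (wmax u) :: 'a poly"
    have deg: "degree ?p \<le> n"
      using degree_tbinom[of "wmax u", where 'a = 'a] wmax_le_length[OF pu] len by linarith
    have "?p = (\<Sum>k\<le>n. monom (coeff ?p k) k)"
      by (rule poly_as_sum_of_monoms'[OF deg, symmetric])
    also have "\<dots> = (\<Sum>k=1..n. monom (coeff ?p k) k)"
      using coeff_tbinom_0[OF pos, where 'a = 'a]
      by (intro sum.mono_neutral_right) (auto simp: not_less_eq_eq)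
    finally show ?thesis using True by (simp add: lookup_sum sc lookup_sigma lookup_E)
  next
    case False
    then show ?thesis by (simp add: lookup_sum sc lookup_sigma lookup_E)
  qed
qed


section \<open>Goldberg coefficients\<close>

text \<open>A formal series in the noncommuting variables \<open>a\<^sub>1, a\<^sub>2, \<dots>\<close> is given by its coefficient
  on each word in the letters \<open>1, 2, \<dots>\<close>.\<close>

type_synonym 'a series = "nat list \<Rightarrow> 'a"

definition series_one :: "'a::comm_ring_1 series" where
  "series_one w = (if w = [] then 1 else 0)"

definition series_mult :: "'a::comm_ring_1 series \<Rightarrow> 'a series \<Rightarrow> 'a series" where
  "series_mult f h w = (\<Sum>i\<le>length w. f (take i w) * h (drop i w))"

primrec series_power :: "'a::comm_ring_1 series \<Rightarrow> nat \<Rightarrow> 'a series" where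
  "series_power f 0 = series_one"
| "series_power f (Suc k) = series_mult f (series_power f k)"

definition exp_letter :: "nat \<Rightarrow> 'a::field_char_0 series" where
  "exp_letter i w = (if set w \<subseteq> {i} then 1 / fact (length w) else 0)"

text \<open>\<open>exp_prod r\<close> is \<open>e\<^bsup>a\<^sub>1\<^esup> \<cdots> e\<^bsup>a\<^sub>r\<^esup>\<close>. The coefficient of a word in the infinite product is read off
  once all its letters have been reached; see \<open>exp_prod_stable\<close>.\<close>

primrec exp_prod :: "nat \<Rightarrow> 'a::field_char_0 series" where
  "exp_prod 0 = series_one"
| "exp_prod (Suc r) = series_mult (exp_prod r) (exp_letter (Suc r))"

definition g_series :: "'a::field_char_0 series" where
  "g_series w = exp_prod (wmax w) w"

lemma exp_prod_stable: "wmax w \<le> r \<Longrightarrow> exp_prod r w = (g_series w :: 'a::field_char_0)"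
proof (induction r rule: dec_induct)
  case base
  then show ?case by (simp add: g_series_def)
next
  case (step r)
  have z: "exp_letter (Suc r) (drop i w) = (0 :: 'a)" if "i < length w" for i
  proof -
    have "w ! i \<in> set (drop i w)" using that by (simp add: Cons_nth_drop_Suc[symmetric])
    moreover have "w ! i \<le> wmax w" using that by (simp add: wmax_def)
    ultimately show ?thesis using step(1) by (auto simp: exp_letter_def)
  qed
  have "(exp_prod (Suc r) w :: 'a) = (\<Sum>i\<in>{length w}. exp_prod r (take i w) * exp_letter (Suc r) (drop i w))"
    unfolding exp_prod.simps series_mult_def
    by (intro sum.mono_neutral_right) (auto simp: z)
  then show ?case using step by (simp add: exp_letter_def)
qed

text \<open>\<open>g_power_t\<close> is \<open>g\<^sup>t = \<Sum>\<^sub>k (t choose k) (g - 1)\<^sup>k\<close>. Since \<open>g - 1\<close> has no constant term, the terms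
  with \<open>k > length w\<close> do not contribute to the coefficient of \<open>w\<close>; see \<open>series_power_eq_0\<close>.\<close>

definition g_minus_one :: "'a::field_char_0 series" where
  "g_minus_one w = g_series w - series_one w"

definition g_power_t :: "nat list \<Rightarrow> 'a::field_char_0 poly" where
  "g_power_t w = (\<Sum>k\<le>length w. smult (series_power g_minus_one k w) (tbinom k))"

lemma g_minus_one_Nil: "g_minus_one [] = 0"
  by (simp add: g_minus_one_def g_series_def wmax_def series_one_def)

lemma series_power_eq_0: "length w < k \<Longrightarrow> series_power g_minus_one k w = (0 :: 'a::field_char_0)"
proof (induction k arbitrary: w)
  case (Suc k)
  have "g_minus_one (take i w) * series_power g_minus_one k (drop i w) = (0 :: 'a)" if "i \<le> length w" for i
  proof (cases "i = 0")
    case False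
    then have "length (drop i w) < k" using Suc.prems that by auto
    then show ?thesis by (simp only: Suc.IH mult_zero_right)
  qed (simp add: g_minus_one_Nil)
  then show ?case
    unfolding series_power.simps series_mult_def by (intro sum.neutral) blast
qed simp

text \<open>A packed word \<open>u\<close> occurs in \<open>M\<^sub>u\<close> and in no other \<open>M\<^sub>v\<close>, so \<open>c\<^sub>u\<close> is the coefficient of the
  word \<open>u\<close> itself.\<close>

definition goldberg :: "nat list \<Rightarrow> 'a::field_char_0 poly" where
  "goldberg u = g_power_t u"

end

theory Submission
  imports Defs "HOL-Computational_Algebra.Formal_Power_Series"
begin

text \<open>
  Compare the coefficients of \<open>N\<^sub>x\<close>, which are polynomials in \<open>t\<close>, at \<open>t = m\<close> for natural \<open>m\<close>.
  On the left this counts the words \<open>f\<close> over \<open>{1..m}\<close> for which the word of triples \<open>(u, f, v)\<close>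
  packs to \<open>x\<close>, that is, the strictly increasing sequences of triples whose projection to \<open>(u, v)\<close>
  is the word \<open>z\<close> of pairs carried by the blocks of \<open>x\<close>. It is the coefficient of \<open>z\<close> in an ordered
  product of factors \<open>1 + a\<close>. On the right, the coefficient of \<open>N\<^sub>x\<close> in \<open>K\<^sub>w\<close> is the product of
  \<open>(-1) ^ (k - 1) / k\<close>, where \<open>k\<close> runs over the numbers of blocks of \<open>x\<close> inside the blocks of \<open>w\<close>,
  so summing over \<open>w\<close> amounts to substituting \<open>log (1 + a)\<close> for every letter \<open>a\<close> in the product of
  exponentials whose coefficients are products of Goldberg coefficients at \<open>t = m\<close>. Both sides
  agree because \<open>exp (log (1 + a)) = 1 + a\<close>.
\<close>

section \<open>Products of one-letter series\<close>

text \<open>The product \<open>series_mult\<close> over an arbitrary alphabet: besides natural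
  numbers, pairs and the one-element type occur as letters below.\<close>

definition conv :: "('l list \<Rightarrow> 'a::comm_ring_1) \<Rightarrow> ('l list \<Rightarrow> 'a) \<Rightarrow> 'l list \<Rightarrow> 'a" where
  "conv f h w = (\<Sum>i\<le>length w. f (take i w) * h (drop i w))"

definition conv_one :: "'l list \<Rightarrow> 'a::comm_ring_1" where
  "conv_one w = (if w = [] then 1 else 0)"

lemma conv_Nil [simp]: "conv f h [] = f [] * h []"
  by (simp add: conv_def)

lemma conv_Cons: "conv f h (a # w) = f [] * h (a # w) + conv (\<lambda>v. f (a # v)) h w"
  unfolding conv_def by (simp add: sum.atMost_Suc_shift del: sum.atMost_Suc)

lemma conv_add_left: "conv (\<lambda>v. f v + g v) h w = conv f h w + conv g h w"
  by (simp add: conv_def sum.distrib algebra_simps)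

lemma conv_scale_left: "conv (\<lambda>v. c * f v) h w = c * conv f h w"
  by (simp add: conv_def sum_distrib_left algebra_simps)

lemma conv_sum_right: "conv f (\<lambda>v. \<Sum>k\<in>A. c k * g k v) w = (\<Sum>k\<in>A. c k * conv f (g k) w)"
proof -
  have "conv f (\<lambda>v. \<Sum>k\<in>A. c k * g k v) w
      = (\<Sum>i\<le>length w. \<Sum>k\<in>A. c k * (f (take i w) * g k (drop i w)))"
    unfolding conv_def by (simp add: sum_distrib_left mult_ac)
  also have "\<dots> = (\<Sum>k\<in>A. \<Sum>i\<le>length w. c k * (f (take i w) * g k (drop i w)))"
    by (rule sum.swap)
  finally show ?thesis by (simp add: conv_def sum_distrib_left)
qed

text \<open>Splitting off the first letter with \<open>conv_Cons\<close> turns the left factor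
  \<open>f\<close> into \<open>\<lambda>v. f (a # v)\<close>, so the induction is over the word with
  \<open>f\<close> arbitrary.\<close>

lemma conv_assoc: "conv (conv f g) h w = conv f (conv g h) w"
proof (induction w arbitrary: f)
  case (Cons a w)
  have "conv (\<lambda>v. conv f g (a # v)) h w
      = f [] * conv (\<lambda>v. g (a # v)) h w + conv (\<lambda>v. f (a # v)) (conv g h) w"
    by (simp add: conv_Cons conv_add_left conv_scale_left Cons.IH)
  then show ?case by (simp add: conv_Cons algebra_simps)
qed (simp add: mult.assoc)

lemma conv_one_left [simp]: "conv conv_one f = f"
proof
  fix w
  have "conv conv_one f w = (\<Sum>i\<in>{0}. conv_one (take i w) * f (drop i w))"
    unfolding conv_def by (intro sum.mono_neutral_right) (auto simp: conv_one_def)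
  then show "conv conv_one f w = f w" by (simp add: conv_one_def)
qed

lemma conv_one_right [simp]: "conv f conv_one = f"
proof
  fix w
  have "conv f conv_one w = (\<Sum>i\<in>{length w}. f (take i w) * conv_one (drop i w))"
    unfolding conv_def by (intro sum.mono_neutral_right) (auto simp: conv_one_def)
  then show "conv f conv_one w = f w" by (simp add: conv_one_def)
qed

text \<open>The power series with coefficients \<open>\<alpha>\<close>, evaluated at the letter
  \<open>l\<close>. Two choices matter: \<open>1 / fact k\<close> gives the exponential of
  \<open>l\<close>, and \<open>subset_coeff\<close> gives \<open>1 + l\<close>.\<close>

definition letter_series :: "(nat \<Rightarrow> 'a::comm_ring_1) \<Rightarrow> 'l \<Rightarrow> 'l list \<Rightarrow> 'a" where
  "letter_series \<alpha> l w = (if set w \<subseteq> {l} then \<alpha> (length w) else 0)"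

text \<open>The factors are multiplied in the order of the list. Letters may be repeated in it,
  which is how powers of a product are formed.\<close>

primrec prod_series :: "(nat \<Rightarrow> 'a::comm_ring_1) \<Rightarrow> 'l list \<Rightarrow> 'l list \<Rightarrow> 'a" where
  "prod_series \<alpha> [] = conv_one"
| "prod_series \<alpha> (l # L) = conv (letter_series \<alpha> l) (prod_series \<alpha> L)"

lemma prod_series_append: "prod_series \<alpha> (L @ L') = conv (prod_series \<alpha> L) (prod_series \<alpha> L')"
  by (induction L) (auto simp: conv_assoc)

lemma prod_series_single [simp]: "prod_series \<alpha> [l] = letter_series \<alpha> l"
  by simp

lemma prod_series_Nil:
  assumes "\<alpha> 0 = 1"
  shows "prod_series \<alpha> L [] = 1"
  by (induction L) (auto simp: conv_one_def letter_series_def assms)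

lemma prod_series_support: "prod_series \<alpha> L w \<noteq> 0 \<Longrightarrow> set w \<subseteq> set L"
proof (induction L arbitrary: w)
  case Nil
  then show ?case by (auto simp: conv_one_def split: if_splits)
next
  case (Cons l L)
  then obtain i where "letter_series \<alpha> l (take i w) * prod_series \<alpha> L (drop i w) \<noteq> 0"
    by (auto simp: conv_def elim: sum.not_neutral_contains_not_neutral)
  then have "letter_series \<alpha> l (take i w) \<noteq> 0" "prod_series \<alpha> L (drop i w) \<noteq> 0" by auto
  then have "set (take i w) \<subseteq> {l}" "set (drop i w) \<subseteq> set L"
    using Cons.IH by (auto simp: letter_series_def split: if_splits)
  moreover have "set w = set (take i w) \<union> set (drop i w)"
    by (metis append_take_drop_id set_append)
  ultimately show ?case by auto
qed

text \<open>Only the cut at \<open>length w\<close> contributes: an earlier cut leaves a letter of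
  \<open>A\<close> to the second factor, a later one gives a letter of \<open>B\<close> to the
  first, against \<open>prod_series_support\<close>.\<close>

lemma prod_series_append_append:
  assumes "A \<inter> B = {}" "set L \<subseteq> A" "set w \<subseteq> A" "set L' \<subseteq> B" "set w' \<subseteq> B"
  shows "prod_series \<alpha> (L @ L') (w @ w') = prod_series \<alpha> L w * prod_series \<alpha> L' w'"
proof -
  let ?P = "prod_series \<alpha>"
  have "?P L (take i (w @ w')) * ?P L' (drop i (w @ w')) = 0" if "i \<noteq> length w" "i \<le> length (w @ w')" for i
  proof (rule ccontr)
    assume "\<not> ?thesis"
    then have "?P L (take i (w @ w')) \<noteq> 0" "?P L' (drop i (w @ w')) \<noteq> 0" by auto
    from this[THEN prod_series_support]
    have sub: "set (take i (w @ w')) \<subseteq> set L" "set (drop i (w @ w')) \<subseteq> set L'" by auto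
    show False
    proof (cases "i < length w")
      case True
      then have "w ! i \<in> set w" "w ! i \<in> set (drop i (w @ w'))"
        by (auto simp: Cons_nth_drop_Suc[symmetric])
      then show False using assms sub by blast
    next
      case False
      then have "w' ! 0 \<in> set w'" "w' ! 0 \<in> set (take i (w @ w'))"
        using that by (auto simp: in_set_conv_nth intro!: exI[of _ 0])
      then show False using assms sub by blast
    qed
  qed
  then have "?P (L @ L') (w @ w') = (\<Sum>i\<in>{length w}. ?P L (take i (w @ w')) * ?P L' (drop i (w @ w')))"
    unfolding prod_series_append conv_def by (intro sum.mono_neutral_right) auto
  then show ?thesis by simp
qed

lemma prod_series_concat:
  assumes "distinct is" and "\<And>i j. i \<in> set is \<Longrightarrow> j \<in> set is \<Longrightarrow> i \<noteq> j \<Longrightarrow> A i \<inter> A j = {}"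
    and "\<And>i. i \<in> set is \<Longrightarrow> set (L i) \<subseteq> A i" and "\<And>i. i \<in> set is \<Longrightarrow> set (y i) \<subseteq> A i"
  shows "prod_series \<alpha> (concat (map L is)) (concat (map y is)) = (\<Prod>i\<in>set is. prod_series \<alpha> (L i) (y i))"
  using assms
proof (induction "is")
  case (Cons i "is")
  have "prod_series \<alpha> (L i @ concat (map L is)) (y i @ concat (map y is))
      = prod_series \<alpha> (L i) (y i) * prod_series \<alpha> (concat (map L is)) (concat (map y is))"
  proof (rule prod_series_append_append)
    show "A i \<inter> (\<Union>j\<in>set is. A j) = {}" using Cons.prems(1,2) by fastforce
    show "set (concat (map L is)) \<subseteq> (\<Union>j\<in>set is. A j)" "set (concat (map y is)) \<subseteq> (\<Union>j\<in>set is. A j)"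
      using Cons.prems(3,4) by fastforce+
  qed (use Cons.prems(3,4) in auto)
  also have "prod_series \<alpha> (concat (map L is)) (concat (map y is)) = (\<Prod>i\<in>set is. prod_series \<alpha> (L i) (y i))"
    using Cons.prems by (intro Cons.IH) auto
  finally show ?case using Cons.prems(1) by simp
qed (simp add: conv_one_def)

text \<open>Used to replace the ranks produced by packing by the letters they stand for; rank
  functions are in general injective only on the letters concerned.\<close>

lemma prod_series_map:
  assumes "inj_on \<rho> (set L \<union> set w)"
  shows "prod_series \<alpha> (map \<rho> L) (map \<rho> w) = prod_series \<alpha> L w"
  using assms
proof (induction L arbitrary: w)
  case (Cons l L)
  have "letter_series \<alpha> (\<rho> l) (map \<rho> (take i w)) = letter_series \<alpha> l (take i w)" for i
  proof -
    have "\<rho> ` set (take i w) \<subseteq> {\<rho> l} \<longleftrightarrow> set (take i w) \<subseteq> {l}"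
      using Cons.prems set_take_subset[of i w] by (auto simp: inj_on_def subset_iff)
    then show ?thesis by (simp add: letter_series_def)
  qed
  moreover have "prod_series \<alpha> (map \<rho> L) (map \<rho> (drop i w)) = prod_series \<alpha> L (drop i w)" for i
    using Cons.prems set_drop_subset[of i w] by (intro Cons.IH) (auto intro: inj_on_subset)
  ultimately show ?case by (simp add: conv_def take_map drop_map)
qed (simp add: conv_one_def)

section \<open>Powers of \<open>g\<close> and Goldberg coefficients at natural values of
  \<open>t\<close>\<close>

lemma series_mult_eq_conv: "series_mult f h = conv f h"
  by (intro ext) (simp add: series_mult_def conv_def)

lemma series_one_eq_conv_one: "series_one = conv_one"
  by (intro ext) (simp add: series_one_def conv_one_def)

lemma exp_prod_eq_prod_series:
  "exp_prod r = (prod_series (\<lambda>k. 1 / fact k) [1..<Suc r] :: 'a::field_char_0 series)"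
proof (induction r)
  case (Suc r)
  have "exp_letter i = (letter_series (\<lambda>k. 1 / fact k) i :: 'a series)" for i
    by (intro ext) (simp add: exp_letter_def letter_series_def)
  then show ?case
    using Suc by (simp add: prod_series_append series_mult_eq_conv del: prod_series.simps(2))
qed (simp add: series_one_eq_conv_one)

text \<open>The infinite product may be cut off after the letter \<open>r\<close>, since no prefix
  or suffix of \<open>w\<close> has a larger letter; the \<open>m\<close>-th power then becomes
  \<open>m\<close> copies of the list of letters.\<close>

lemma series_power_g_series:
  assumes "set w \<subseteq> {..r}"
  shows "series_power g_series m w =
    (prod_series (\<lambda>k. 1 / fact k) (concat (replicate m [1..<Suc r])) w :: 'a::field_char_0)"
  using assms
proof (induction m arbitrary: w)
  case (Suc m)
  have "g_series (take i w) = (exp_prod r (take i w) :: 'a)" for i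
    by (rule exp_prod_stable[symmetric]) (use Suc.prems set_take_subset[of i w] in \<open>auto simp: wmax_def\<close>)
  moreover have "series_power g_series m (drop i w)
      = (prod_series (\<lambda>k. 1 / fact k) (concat (replicate m [1..<Suc r])) (drop i w) :: 'a)" for i
    using Suc.prems set_drop_subset[of i w] by (intro Suc.IH) auto
  ultimately show ?case
    by (simp add: series_mult_eq_conv prod_series_append conv_def exp_prod_eq_prod_series del: upt_Suc)
qed (simp add: series_one_eq_conv_one)

text \<open>Binomial theorem for \<open>1 + (g - 1)\<close>: one more factor \<open>g\<close> gives
  two sums, which combine by Pascal's rule.\<close>

lemma series_power_g_series_binomial:
  "series_power g_series m w = (\<Sum>k\<le>m. of_nat (m choose k) * series_power g_minus_one k w :: 'a::field_char_0)"
proof (induction m arbitrary: w)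
  case (Suc m)
  let ?h = "g_minus_one :: 'a series"
  have g: "g_series = (\<lambda>v. conv_one v + ?h v)"
    by (intro ext) (simp add: g_minus_one_def series_one_eq_conv_one)
  have "conv g_series f v = f v + conv ?h f v" for f v
    unfolding g by (simp add: conv_add_left)
  moreover have "series_power g_series m = (\<lambda>w. \<Sum>k\<le>m. of_nat (m choose k) * series_power ?h k w)"
    using Suc.IH by blast
  ultimately have "series_power g_series (Suc m) w =
      (\<Sum>k\<le>m. of_nat (m choose k) * series_power ?h k w) + (\<Sum>k\<le>m. of_nat (m choose k) * series_power ?h (Suc k) w)"
    by (simp add: series_mult_eq_conv conv_sum_right sum.distrib distrib_left)
  \<comment> \<open>Pulling out \<open>k = 0\<close> shifts the index; the new top term contains
    \<open>m choose Suc m\<close>, which is 0.\<close>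
  also have "(\<Sum>k\<le>m. of_nat (m choose k) * series_power ?h k w)
      = series_power ?h 0 w + (\<Sum>k\<le>m. of_nat (m choose Suc k) * series_power ?h (Suc k) w)"
    using sum.atMost_Suc_shift[of "\<lambda>k. of_nat (m choose k) * series_power ?h k w" m]
    by (simp add: binomial_eq_0)
  finally show ?case
    by (simp add: sum.atMost_Suc_shift sum.distrib algebra_simps del: sum.atMost_Suc series_power.simps(2))
qed simp

text \<open>The two sums end at \<open>length w\<close> and at \<open>m\<close>. Terms with
  \<open>k > length w\<close> vanish by \<open>series_power_eq_0\<close>, terms with
  \<open>k > m\<close> by their binomial coefficient.\<close>

lemma poly_g_power_t:
  "poly (g_power_t w) (of_nat m) = (series_power g_series m w :: 'a::field_char_0)"
proof -
  let ?f = "\<lambda>k. of_nat (m choose k) * series_power g_minus_one k w :: 'a"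
  have "poly (g_power_t w) (of_nat m) = (\<Sum>k\<le>length w. ?f k)"
    by (simp add: g_power_t_def poly_sum poly_tbinom binomial_gbinomial mult.commute)
  also have "\<dots> = (\<Sum>k\<le>m. ?f k)"
  proof (rule sum.mono_neutral_cong)
    fix k assume "k \<in> {..m} - {..length w}"
    then have "length w < k" by auto
    then show "?f k = 0" by (simp only: series_power_eq_0 mult_zero_right)
  qed (auto simp: binomial_eq_0)
  finally show ?thesis by (simp add: series_power_g_series_binomial)
qed

section \<open>Substitution of the logarithm\<close>

definition expand :: "('l \<times> nat) list \<Rightarrow> 'l list" where
  "expand bs = concat (map (\<lambda>q. replicate (snd q) (fst q)) bs)"

text \<open>Adjacent runs may carry the same letter, so a constant word of length \<open>k\<close>
  has one decomposition for each composition of \<open>k\<close>.\<close>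

definition run_decomps :: "'l list \<Rightarrow> ('l \<times> nat) list set" where
  "run_decomps w = {bs. (\<forall>q\<in>set bs. 0 < snd q) \<and> expand bs = w}"

text \<open>With these coefficients the letter series is \<open>1 + a\<close>.\<close>

definition subset_coeff :: "nat \<Rightarrow> 'a::comm_ring_1" where
  "subset_coeff k = (if k \<le> 1 then 1 else 0)"

text \<open>The coefficients of \<open>log (1 + X)\<close>: \<open>(-1) ^ (k - 1) / k\<close> for
  positive \<open>k\<close>, and 0 for \<open>k = 0\<close>.\<close>

definition log_coeff :: "nat \<Rightarrow> 'a::field_char_0" where
  "log_coeff k = fps_nth (fps_ln 1) k"

definition log_weight :: "('l \<times> nat) list \<Rightarrow> 'a::field_char_0" where
  "log_weight bs = prod_list (map (\<lambda>q. log_coeff (snd q)) bs)"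

text \<open>The substitution \<open>a \<mapsto> log (1 + a)\<close> for all letters \<open>a\<close>.\<close>

definition log_subst :: "('l list \<Rightarrow> 'a::field_char_0) \<Rightarrow> 'l list \<Rightarrow> 'a" where
  "log_subst F w = (\<Sum>bs\<in>run_decomps w. F (map fst bs) * log_weight bs)"

lemma expand_simps [simp]:
  "expand [] = []" "expand (q # bs) = replicate (snd q) (fst q) @ expand bs"
  "expand (bs @ bs') = expand bs @ expand bs'"
  by (simp_all add: expand_def)

lemma set_map_fst_run_decomps: "bs \<in> run_decomps w \<Longrightarrow> set (map fst bs) = set w"
proof (induction bs arbitrary: w)
  case (Cons q bs)
  then have "bs \<in> run_decomps (expand bs)" and w: "w = replicate (snd q) (fst q) @ expand bs" "0 < snd q"
    by (simp_all add: run_decomps_def)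
  from Cons.IH[OF this(1)] show ?case by (simp add: w)
qed (simp add: run_decomps_def)

lemma length_le_length_expand: "\<forall>q\<in>set bs. 0 < snd q \<Longrightarrow> length bs \<le> length (expand bs)"
  by (induction bs) auto

lemma finite_run_decomps: "finite (run_decomps w)"
proof (rule finite_subset)
  show "run_decomps w \<subseteq> {bs. set bs \<subseteq> set w \<times> {..length w} \<and> length bs \<le> length w}"
  proof
    fix bs assume bs: "bs \<in> run_decomps w"
    have "snd q \<le> length (expand bs)" if "q \<in> set bs" for q
      using that by (induction bs) auto
    then have "snd q \<le> length w" if "q \<in> set bs" for q
      using bs that by (simp add: run_decomps_def)
    moreover have "fst q \<in> set w" if "q \<in> set bs" for q
      using that unfolding set_map_fst_run_decomps[OF bs, symmetric] by simp
    moreover have "length bs \<le> length w"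
      using bs length_le_length_expand[of bs] by (simp add: run_decomps_def)
    ultimately show "bs \<in> {bs. set bs \<subseteq> set w \<times> {..length w} \<and> length bs \<le> length w}"
      by (auto simp: mem_Times_iff)
  qed
  show "finite {bs. set bs \<subseteq> set w \<times> {..length w} \<and> length bs \<le> length w}"
    by (rule finite_lists_length_le) simp
qed

text \<open>Substitution is multiplicative: decomposing \<open>w\<close> and cutting the list of
  runs amounts to cutting \<open>w\<close> and decomposing both pieces.\<close>

lemma log_subst_conv:
  fixes F G :: "'l list \<Rightarrow> 'a::field_char_0"
  shows "log_subst (conv F G) w = conv (log_subst F) (log_subst G) w"
proof -
  let ?A = "SIGMA bs:run_decomps w. {..length bs}"
  let ?B = "SIGMA i:{..length w}. run_decomps (take i w) \<times> run_decomps (drop i w)"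
  let ?g = "\<lambda>(bs, i). F (map fst (take i bs)) * G (map fst (drop i bs)) * log_weight bs"
  let ?h = "\<lambda>(i, bs, bs'). (F (map fst bs) * log_weight bs) * (G (map fst bs') * log_weight bs')"
  have "log_subst (conv F G) w = sum ?g ?A"
    unfolding log_subst_def conv_def
    by (subst sum.Sigma[symmetric]) (auto simp: finite_run_decomps sum_distrib_right take_map drop_map)
  also have "\<dots> = sum ?h ?B"
  \<comment> \<open>A cut after \<open>i\<close> runs corresponds to the cut of \<open>w\<close> at
    their total length; conversely two decompositions are joined and cut where the first
    ends.\<close>
  proof (rule sum.reindex_bij_witness)
    show "(\<lambda>(i, bs, bs'). (bs @ bs', length bs))
        ((\<lambda>(bs, i). (length (expand (take i bs)), take i bs, drop i bs)) a) = a" if "a \<in> ?A" for a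
      using that by auto
    show "(\<lambda>(bs, i). (length (expand (take i bs)), take i bs, drop i bs)) a \<in> ?B" if a: "a \<in> ?A" for a
    proof -
      obtain bs i where *: "a = (bs, i)" "bs \<in> run_decomps w" by (cases a) (use a in auto)
      have w: "w = expand (take i bs) @ expand (drop i bs)"
        using *(2) unfolding expand_simps(3)[symmetric] by (simp add: run_decomps_def)
      show ?thesis using *
        by (auto simp: run_decomps_def w dest: in_set_takeD in_set_dropD simp del: append_take_drop_id)
    qed
    show "(\<lambda>(bs, i). (length (expand (take i bs)), take i bs, drop i bs))
        ((\<lambda>(i, bs, bs'). (bs @ bs', length bs)) b) = b" if "b \<in> ?B" for b
      using that by (auto simp: run_decomps_def)
    show "(\<lambda>(i, bs, bs'). (bs @ bs', length bs)) b \<in> ?A" if "b \<in> ?B" for b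
      using that by (cases b) (fastforce simp: run_decomps_def)
    show "?h ((\<lambda>(bs, i). (length (expand (take i bs)), take i bs, drop i bs)) a) = ?g a" if "a \<in> ?A" for a
    proof -
      obtain bs i where *: "a = (bs, i)" by (cases a)
      have "log_weight bs = (log_weight (take i bs) * log_weight (drop i bs) :: 'a)"
        by (metis (no_types) log_weight_def append_take_drop_id map_append prod_list.append)
      then show ?thesis by (simp add: * mult_ac)
    qed
  qed
  also have "\<dots> = conv (log_subst F) (log_subst G) w"
    unfolding log_subst_def conv_def
    by (subst sum.Sigma[symmetric])
       (auto simp: finite_run_decomps sum_product sum.cartesian_product intro!: sum.cong)
  finally show ?thesis .
qed

section \<open>Cancellation of exponential and logarithm\<close>

lemma fps_ln_power_nth:
  "fps_nth (fps_ln (1 :: 'a::field_char_0) ^ r) k =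
    (\<Sum>ks | length ks = r \<and> sum_list ks = k. prod_list (map log_coeff ks))"
proof (cases r)
  case 0
  have *: "{ks. ks = [] \<and> sum_list ks = k} = (if k = 0 then {[]} else {})" by auto
  show ?thesis by (simp add: 0 *)
next
  case (Suc m)
  have "(\<Prod>j=0..m. log_coeff (ks ! j)) = (prod_list (map log_coeff ks) :: 'a)" if "length ks = Suc m" for ks
    using that by (simp add: prod.list_conv_set_nth atLeastLessThanSuc_atLeastAtMost)
  then show ?thesis unfolding Suc fps_power_nth_Suc
    by (auto simp: natpermute_def log_coeff_def intro!: sum.cong)
qed

text \<open>This is \<open>exp (log (1 + l)) = 1 + l\<close>: the decompositions of a constant word
  of length \<open>k\<close> are the compositions of \<open>k\<close>, and grouping them by the
  number of parts gives the \<open>k\<close>-th coefficient of the composed series.\<close>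

lemma log_subst_letter_series:
  "log_subst (letter_series (\<lambda>k. 1 / fact k) l) w =
    (letter_series subset_coeff l w :: 'a::field_char_0)"
proof (cases "set w \<subseteq> {l}")
  case False
  have "letter_series (\<lambda>k. 1 / fact k :: 'a) l (map fst bs) = 0" if "bs \<in> run_decomps w" for bs
    using False unfolding letter_series_def set_map_fst_run_decomps[OF that] by simp
  then show ?thesis using False by (simp add: log_subst_def letter_series_def)
next
  case True
  define k where "k = length w"
  have w: "w = replicate k l"
    unfolding k_def by (rule replicate_eqI) (use True in auto)
  let ?pos = "\<lambda>r. {ks. length ks = r \<and> sum_list ks = k \<and> (\<forall>i\<in>set ks. 0 < i)}"
  have ex: "expand (map (Pair l) ks) = replicate (sum_list ks) l" for ks
    by (induction ks) (auto simp: replicate_add)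
  have decomps: "run_decomps w = map (Pair l) ` (\<Union>r\<le>k. ?pos r)"
  proof (intro subset_antisym subsetI)
    fix bs assume bs: "bs \<in> run_decomps w"
    have fsts: "\<forall>q\<in>set bs. fst q = l" using set_map_fst_run_decomps[OF bs] True by auto
    have eq: "bs = map (Pair l) (map snd bs)"
      using fsts by (induction bs) auto
    have "replicate (sum_list (map snd bs)) l = replicate k l"
      using bs w eq ex[of "map snd bs"] by (simp add: run_decomps_def)
    then have "sum_list (map snd bs) = k" by (metis length_replicate)
    moreover have "length bs \<le> k" using bs length_le_length_expand[of bs] by (auto simp: run_decomps_def k_def)
    ultimately show "bs \<in> map (Pair l) ` (\<Union>r\<le>k. ?pos r)"
      using bs by (subst eq, intro imageI) (auto simp: run_decomps_def)
  qed (auto simp: run_decomps_def ex w)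
  have fin: "finite {ks. length ks = r \<and> sum_list ks = k}" for r
    using natpermute_finite[of k r] by (simp add: natpermute_def)
  have inj: "inj_on (map (Pair l)) A" for A
    by (simp add: inj_on_def)
  have "log_subst (letter_series (\<lambda>k. 1 / fact k) l) w
      = (\<Sum>ks\<in>(\<Union>r\<le>k. ?pos r). 1 / fact (length ks) * prod_list (map log_coeff ks) :: 'a)"
    unfolding log_subst_def decomps sum.reindex[OF inj]
    by (intro sum.cong) (auto simp: letter_series_def log_weight_def o_def)
  also have "\<dots> = (\<Sum>r\<le>k. \<Sum>ks\<in>?pos r. 1 / fact (length ks) * prod_list (map log_coeff ks))"
    by (rule sum.UNION_disjoint) (auto intro: finite_subset[OF _ fin])
  also have "\<dots> = (\<Sum>r\<le>k. 1 / fact r * fps_nth (fps_ln 1 ^ r) k)"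
  proof (rule sum.cong[OF refl])
    fix r
    \<comment> \<open>Zero parts, which the expansion of the power admits, contribute nothing
      because \<open>log_coeff 0 = 0\<close>.\<close>
    have "(\<Sum>ks\<in>?pos r. prod_list (map log_coeff ks) :: 'a)
        = (\<Sum>ks | length ks = r \<and> sum_list ks = k. prod_list (map log_coeff ks))"
      by (rule sum.mono_neutral_left)
         (use fin in \<open>auto simp: prod_list_zero_iff log_coeff_def image_iff intro: bexI[of _ 0]\<close>)
    then show "(\<Sum>ks\<in>?pos r. 1 / fact (length ks) * prod_list (map log_coeff ks))
        = (1 / fact r * fps_nth (fps_ln 1 ^ r) k :: 'a)"
      unfolding fps_ln_power_nth by (simp add: sum_distrib_left[symmetric] sum_divide_distrib[symmetric])
  qed
  also have "\<dots> = fps_nth (fps_compose (fps_exp 1) (fps_ln 1)) k"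
    by (simp add: fps_compose_nth atLeast0AtMost)
  also have "fps_compose (fps_exp (1::'a)) (fps_ln 1) = 1 + fps_X"
  proof -
    \<comment> \<open>Subtracting 1 removes the constant term, so that a compositional inverse
      exists; it is \<open>fps_ln 1\<close>.\<close>
    have "fps_compose (fps_exp (1::'a) - 1) (fps_ln 1) = fps_X"
      unfolding fps_ln_fps_exp_inv[OF one_neq_zero] by (rule fps_inv_right) simp_all
    then show ?thesis by (simp add: fps_compose_sub_distrib algebra_simps)
  qed
  also have "fps_nth (1 + fps_X) k = letter_series subset_coeff l w"
    by (auto simp: w letter_series_def fps_X_def subset_coeff_def)
  finally show ?thesis .
qed

lemma log_subst_prod_series:
  "log_subst (prod_series (\<lambda>k. 1 / fact k) L) w =
    (prod_series subset_coeff L w :: 'a::field_char_0)"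
proof (induction L arbitrary: w)
  case Nil
  have *: "run_decomps [] = {[]}"
    using set_map_fst_run_decomps[of _ "[]"] by (auto simp: run_decomps_def)
  show ?case
  proof (cases "w = []")
    case False
    then have "bs \<noteq> []" if "bs \<in> run_decomps w" for bs
      using that by (auto simp: run_decomps_def)
    then show ?thesis using False by (simp add: log_subst_def conv_one_def)
  qed (simp add: log_subst_def * conv_one_def log_weight_def)
next
  case (Cons l L)
  have "(log_subst (prod_series (\<lambda>k. 1 / fact k) (l # L)) w :: 'a)
      = conv (log_subst (letter_series (\<lambda>k. 1 / fact k) l)) (log_subst (prod_series (\<lambda>k. 1 / fact k) L)) w"
    by (simp only: prod_series.simps log_subst_conv)
  also have "\<dots> = conv (letter_series subset_coeff l)
      (prod_series subset_coeff L) w"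
    by (simp only: conv_def log_subst_letter_series Cons.IH)
  finally show ?case by simp
qed

section \<open>Packing\<close>

lemma set_packed: "packed x \<Longrightarrow> set x = {1..wmax x}"
proof -
  assume "packed x"
  then obtain r where r: "set x = {1..r}" by (auto simp: packed_def)
  then have "wmax x = r" by (cases "r = 0") (auto simp: wmax_def intro: Max_eqI)
  with r show ?thesis by simp
qed

lemma nth_packed: "packed x \<Longrightarrow> i < length x \<Longrightarrow> 1 \<le> x ! i \<and> x ! i \<le> wmax x"
  using set_packed[of x] nth_mem[of i x] by auto

text \<open>Stated for any finite set, since ranks are taken among the letters of a word and also
  among the values of \<open>v\<close> on a block of \<open>u\<close>.\<close>

lemma strict_mono_on_rank:
  fixes S :: "'b::linorder set"
  assumes "finite S"
  shows "strict_mono_on S (\<lambda>x. card {y \<in> S. y \<le> x})"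
  by (intro strict_mono_onI psubset_card_mono psubsetI)
     (use assms in \<open>auto dest: order.strict_trans1\<close>)

lemma rank_image:
  fixes S :: "'b::linorder set"
  assumes "finite S"
  shows "(\<lambda>x. card {y \<in> S. y \<le> x}) ` S = {1..card S}"
proof (rule card_subset_eq)
  show "(\<lambda>x. card {y \<in> S. y \<le> x}) ` S \<subseteq> {1..card S}"
    using assms by (auto simp: Suc_le_eq card_gt_0_iff intro: card_mono)
  show "card ((\<lambda>x. card {y \<in> S. y \<le> x}) ` S) = card {1..card S}"
    using strict_mono_on_imp_inj_on[OF strict_mono_on_rank[OF assms]] by (simp add: card_image)
qed simp

lemma map_rank_sorted_list_of_set:
  fixes S :: "'b::linorder set"
  assumes "finite S"
  shows "map (\<lambda>x. card {y \<in> S. y \<le> x}) (sorted_list_of_set S) = [1..<Suc (card S)]"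
proof (rule strict_sorted_equal)
  show "sorted_wrt (<) (map (\<lambda>x. card {y \<in> S. y \<le> x}) (sorted_list_of_set S))"
    unfolding sorted_wrt_map
    by (rule sorted_wrt_mono_rel[OF _ strict_sorted_list_of_set])
       (use strict_mono_on_rank[OF assms] assms in \<open>auto simp: strict_mono_on_def\<close>)
  show "set (map (\<lambda>x. card {y \<in> S. y \<le> x}) (sorted_list_of_set S)) = set [1..<Suc (card S)]"
    using rank_image[OF assms] assms by (simp add: atLeastLessThanSuc_atLeastAtMost del: upt_Suc)
qed (simp del: upt_Suc)

lemma length_pack [simp]: "length (pack y) = length y"
  by (simp add: pack_def)

lemma set_pack: "set (pack y) = {1..card (set y)}"
  using rank_image[of "set y"] by (simp add: pack_def)

lemma wmax_pack: "wmax (pack y) = card (set y)"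
  using set_packed[OF packed_pack, of y] set_pack[of y] by (metis card_atLeastAtMost diff_Suc_1)

lemma pack_le_iff:
  assumes "i < length y" "j < length y"
  shows "pack y ! i \<le> pack y ! j \<longleftrightarrow> y ! i \<le> y ! j"
  using strict_mono_on_less_eq[OF strict_mono_on_rank[of "set y"], of "y ! i" "y ! j"] assms
  by (simp add: pack_def)

lemma pack_map_strict_mono_on:
  assumes "strict_mono_on (set y) \<phi>"
  shows "pack (map \<phi> y) = pack y"
proof -
  have "card {b \<in> \<phi> ` set y. b \<le> \<phi> a} = card {b \<in> set y. b \<le> a}" if "a \<in> set y" for a
  proof -
    have "{b \<in> \<phi> ` set y. b \<le> \<phi> a} = \<phi> ` {b \<in> set y. b \<le> a}"
      using strict_mono_on_less_eq[OF assms] that by auto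
    then show ?thesis
      using strict_mono_on_imp_inj_on[OF assms] by (simp add: card_image inj_on_subset)
  qed
  then show ?thesis by (simp add: pack_def)
qed

lemma pack_packed:
  assumes "packed x"
  shows "pack x = x"
proof -
  have "card {b \<in> set x. b \<le> a} = a" if "a \<in> set x" for a
  proof -
    have "{b \<in> set x. b \<le> a} = {1..a}" using that set_packed[OF assms] by auto
    then show ?thesis by simp
  qed
  then show ?thesis by (simp add: pack_def map_idI)
qed

text \<open>Packing depends only on the order pattern: sending \<open>y ! j\<close> to
  \<open>y' ! j\<close> is a well-defined strictly increasing map of letters, and such maps preserve
  the packing.\<close>

lemma pack_eqI:
  assumes "length y = length y'"
    and "\<And>i j. i < length y \<Longrightarrow> j < length y \<Longrightarrow> y ! i \<le> y ! j \<longleftrightarrow> y' ! i \<le> y' ! j"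
  shows "pack y = pack y'"
proof -
  have eq: "y ! j = y ! k \<longleftrightarrow> y' ! j = y' ! k" if "j < length y" "k < length y" for j k
    using assms(2)[OF that] assms(2)[OF that(2,1)] by (auto intro: order.antisym)
  define \<phi> where "\<phi> a = y' ! (SOME k. k < length y \<and> y ! k = a)" for a
  have \<phi>: "\<phi> (y ! j) = y' ! j" if "j < length y" for j
    unfolding \<phi>_def using someI[of "\<lambda>k. k < length y \<and> y ! k = y ! j" j] that eq by auto
  have "strict_mono_on (set y) \<phi>"
  proof (rule strict_mono_onI)
    fix a b assume "a \<in> set y" "b \<in> set y" "a < b"
    then show "\<phi> a < \<phi> b" using \<phi> assms(2)
      by (metis in_set_conv_nth linorder_not_le)
  qed
  moreover have "map \<phi> y = y'" using \<phi> assms(1) by (auto intro: nth_equalityI)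
  ultimately show ?thesis using pack_map_strict_mono_on by metis
qed

text \<open>Letters of packed words count from 1, list positions from 0.\<close>

definition pull :: "'l list \<Rightarrow> nat list \<Rightarrow> 'l list" where
  "pull z x = map (\<lambda>b. z ! (b - 1)) x"

lemma length_pull [simp]: "length (pull z x) = length x"
  by (simp add: pull_def)

lemma nth_pull: "i < length x \<Longrightarrow> pull z x ! i = z ! (x ! i - 1)"
  by (simp add: pull_def)

lemma set_pull:
  assumes "packed x" "length z = wmax x"
  shows "set (pull z x) = set z"
proof -
  have "set (pull z x) = (\<lambda>b. z ! (b - 1)) ` {1..length z}"
    by (simp add: pull_def set_packed[OF assms(1)] assms(2))
  also have "{1..length z} = Suc ` {..<length z}" by (auto simp: image_iff Suc_le_eq gr0_conv_Suc)
  finally show ?thesis by (auto simp: image_image set_conv_nth)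
qed

text \<open>Every letter from 1 to \<open>wmax x\<close> occurs in \<open>x\<close>, so each entry
  of \<open>z\<close> is visible in \<open>pull z x\<close>.\<close>

lemma pull_inject:
  assumes "packed x" "length z = wmax x" "length z' = wmax x" "pull z x = pull z' x"
  shows "z = z'"
proof (rule nth_equalityI)
  fix b assume "b < length z"
  then have "Suc b \<in> set x" using set_packed[OF assms(1)] assms(2) by auto
  then show "z ! b = z' ! b" using assms(4) by (auto simp: pull_def)
qed (use assms in simp)

lemma map_pull:
  assumes "packed x" "length z = wmax x"
  shows "map f (pull z x) = pull (map f z) x"
proof (rule nth_equalityI)
  fix i assume "i < length (map f (pull z x))"
  then show "map f (pull z x) ! i = pull (map f z) x ! i"
    using nth_packed[OF assms(1), of i] assms(2) by (cases "x ! i") (auto simp: nth_pull)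
qed simp

lemma pull_pull:
  assumes "packed x" "length W = wmax x"
  shows "pull l (pull W x) = pull (pull l W) x"
  using map_pull[OF assms, of "\<lambda>b. l ! (b - 1)"] by (simp add: pull_def)

lemma pack_pull:
  assumes "packed x" "length t = wmax x" "sorted_wrt (<) t"
  shows "pack (pull t x) = x"
proof -
  have "strict_mono_on (set x) (\<lambda>b. t ! (b - 1))"
  proof (rule strict_mono_onI)
    fix a b assume "a \<in> set x" "b \<in> set x" "a < b"
    then show "t ! (a - 1) < t ! (b - 1)"
      using assms set_packed[OF assms(1)] by (intro sorted_wrt_nth_less[of "(<)" t]) auto
  qed
  then show ?thesis unfolding pull_def by (simp add: pack_map_strict_mono_on pack_packed assms(1))
qed

text \<open>Together with \<open>pack_pull\<close> this makes the words that pack to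
  \<open>x\<close> correspond to the strictly increasing lists of length
  \<open>wmax x\<close>.\<close>

lemma pull_pack: "pull (sorted_list_of_set (set y)) (pack y) = y"
proof (rule nth_equalityI)
  fix i assume "i < length (pull (sorted_list_of_set (set y)) (pack y))"
  then have i: "i < length y" by simp
  let ?S = "sorted_list_of_set (set y)"
  obtain j where j: "j < length ?S" "?S ! j = y ! i"
    using i by (metis in_set_conv_nth nth_mem finite_set set_sorted_list_of_set)
  have "pack y ! i = map (\<lambda>x. card {b \<in> set y. b \<le> x}) ?S ! j"
    using i j by (simp add: pack_def)
  also have "\<dots> = Suc j"
    unfolding map_rank_sorted_list_of_set[OF finite_set] using j by (simp del: upt_Suc)
  finally show "pull ?S (pack y) ! i = y ! i" using i j by (simp add: nth_pull)
qed simp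

text \<open>A word that is constant on the blocks of \<open>x\<close> factors through
  \<open>x\<close>; the entry for a block can be read at any position in it.\<close>

lemma exists_pull:
  assumes "packed x" "length y = length x"
    and "\<And>i j. i < length x \<Longrightarrow> j < length x \<Longrightarrow> x ! i = x ! j \<Longrightarrow> y ! i = y ! j"
  shows "\<exists>z. length z = wmax x \<and> pull z x = y"
proof -
  let ?z = "map (\<lambda>b. y ! (SOME j. j < length x \<and> x ! j = Suc b)) [0..<wmax x]"
  have "pull ?z x ! i = y ! i" if i: "i < length x" for i
  proof -
    let ?j = "SOME j. j < length x \<and> x ! j = x ! i"
    have "?j < length x \<and> x ! ?j = x ! i" by (rule someI[of _ i]) (use i in simp)
    then have "y ! ?j = y ! i" using assms(3) i by blast
    then show ?thesis using nth_packed[OF assms(1) i] i by (cases "x ! i") (simp_all add: nth_pull)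
  qed
  then have "pull ?z x = y" using assms(2) by (auto intro: nth_equalityI)
  then show ?thesis by (intro exI[of _ ?z]) simp
qed

section \<open>Counting words with a given packing\<close>

lemma sorted_wrt_concat_map:
  assumes "sorted_wrt (<) is" and "\<And>i. i \<in> set is \<Longrightarrow> sorted_wrt R (f i)"
    and "\<And>i j a b. i < j \<Longrightarrow> a \<in> set (f i) \<Longrightarrow> b \<in> set (f j) \<Longrightarrow> R a b"
  shows "sorted_wrt R (concat (map f is))"
  using assms(1,2) by (induction "is") (auto simp: sorted_wrt_append intro: assms(3))

abbreviation "subset_series \<equiv> prod_series subset_coeff"

text \<open>The factor \<open>1 + l\<close> contributes either the empty word or, if
  \<open>a = l\<close>, the first letter.\<close>

lemma subset_series_Cons_Cons:
  "(subset_series (l # L) (a # w) :: 'a::comm_ring_1) = subset_series L (a # w) + (if a = l then subset_series L w else 0)"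
proof -
  let ?f = "\<lambda>v. letter_series subset_coeff l (a # v) :: 'a"
  have "?f = (\<lambda>v. (if a = l then 1 else 0) * conv_one v)"
    by (intro ext) (auto simp: letter_series_def subset_coeff_def conv_one_def)
  then have "conv ?f (subset_series L) w = (if a = l then 1 else 0) * subset_series L w"
    by (simp only: conv_scale_left conv_one_left)
  then show ?thesis
    by (simp add: conv_Cons letter_series_def[of _ _ "[]"] subset_coeff_def)
qed

lemma subset_series_replicate:
  "subset_series (replicate m l) (replicate k l) = of_nat (m choose k)"
proof (induction m arbitrary: k)
  case 0
  then show ?case by (cases k) (auto simp: conv_one_def)
next
  case (Suc m)
  show ?case
  proof (cases k)
    case (Suc j)
    then show ?thesis
      using Suc.IH[of k] Suc.IH[of j] by (simp add: subset_series_Cons_Cons del: prod_series.simps)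
  qed (simp add: prod_series_Nil subset_coeff_def del: prod_series.simps)
qed

text \<open>Expanding the product of the factors \<open>1 + proj l\<close> means choosing a subset
  of the letters of \<open>L\<close>; listed in increasing order, these subsets are the sequences
  \<open>t\<close>.\<close>

lemma subset_series_eq_card:
  fixes L :: "'b::linorder list"
  assumes "sorted_wrt (<) L"
  shows "(subset_series (map proj L) z :: 'a::comm_ring_1) =
    of_nat (card {t. sorted_wrt (<) t \<and> set t \<subseteq> set L \<and> map proj t = z})"
  using assms
proof (induction L arbitrary: z)
  case Nil
  have "{t. sorted_wrt (<) t \<and> set t \<subseteq> set [] \<and> map proj t = z} = (if z = [] then {[]} else {})"
    by auto
  then show ?case by (simp only: prod_series.simps) (simp add: conv_one_def)
next
  case (Cons l L)
  let ?T = "\<lambda>L z. {t. sorted_wrt (<) t \<and> set t \<subseteq> set L \<and> map proj t = z}"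
  have fin: "finite (?T L z)" for z
    by (rule finite_subset[OF _ finite_lists_length_eq[of "set L" "length z"]]) auto
  have L: "l < b" if "b \<in> set L" for b using Cons.prems that by simp
  show ?case
  proof (cases z)
    case Nil
    then have "?T (l # L) z = {[]}" by auto
    then show ?thesis using Nil by (simp add: prod_series_Nil subset_coeff_def del: prod_series.simps)
  next
    case z: (Cons a z')
    have "?T (l # L) z = ?T L z \<union> (if a = proj l then (#) l ` ?T L z' else {})" 
      (is "_ = _ \<union> ?R")
    proof (intro subset_antisym subsetI)
      fix t assume t: "t \<in> ?T (l # L) z"
      then obtain b t' where b: "t = b # t'" "a = proj b" using z by (cases t) auto
      \<comment> \<open>An occurrence of \<open>l\<close> after the head \<open>b\<close> would
        force \<open>b < l\<close>, but \<open>l\<close> is the least letter.\<close>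
      have "l \<notin> set t'"
      proof
        assume "l \<in> set t'"
        then have "b < l" using t b by auto
        moreover have "b \<in> set (l # L)" using t b by auto
        ultimately show False using L by fastforce
      qed
      then have "set t' \<subseteq> set L" using t b by auto
      then show "t \<in> ?T L z \<union> ?R" using t b z by auto
    next
      fix t assume "t \<in> ?T L z \<union> ?R"
      then show "t \<in> ?T (l # L) z" using z by (auto split: if_splits intro!: L)
    qed
    moreover have finR: "finite ?R" using fin[of z'] by simp
    moreover have "?T L z \<inter> ?R = {}" by (auto dest: L)
    ultimately have "card (?T (l # L) z) = card (?T L z) + card ?R"
      using card_Un_disjoint[OF fin[of z] finR] by metis
    also have "card ?R = (if a = proj l then card (?T L z') else 0)"
      by (simp add: card_image)
    finally have card: "card (?T (l # L) z) = card (?T L z) + (if a = proj l then card (?T L z') else 0)" .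
    have IH: "(subset_series (map proj L) v :: 'a) = of_nat (card (?T L v))" for v
      using Cons by simp
    have "(subset_series (map proj (l # L)) z :: 'a)
        = subset_series (map proj L) z + (if a = proj l then subset_series (map proj L) z' else 0)"
      by (simp only: z list.map subset_series_Cons_Cons)
    then show ?thesis unfolding card IH by (simp only: of_nat_add of_nat_0 if_distrib[of of_nat])
  qed
qed

text \<open>A word \<open>y\<close> that packs to \<open>x\<close> is \<open>pull t x\<close> for a
  strictly increasing list \<open>t\<close>, one letter per block, and it projects to
  \<open>pull z x\<close> exactly when \<open>t\<close> projects to \<open>z\<close>.\<close>

lemma card_pack_eq:
  fixes L :: "'b::linorder list"
  assumes "sorted_wrt (<) L" "packed x" "length z = wmax x"
  shows "of_nat (card {y. set y \<subseteq> set L \<and> pack y = x \<and> map proj y = pull z x}) = subset_series (map proj L) z"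
proof -
  let ?T = "{t. sorted_wrt (<) t \<and> set t \<subseteq> set L \<and> map proj t = z}"
  have im: "{y. set y \<subseteq> set L \<and> pack y = x \<and> map proj y = pull z x} = (\<lambda>t. pull t x) ` ?T"
  proof (intro subset_antisym subsetI)
    fix y assume y: "y \<in> {y. set y \<subseteq> set L \<and> pack y = x \<and> map proj y = pull z x}"
    then have y': "set y \<subseteq> set L" "pack y = x" "map proj y = pull z x" by simp_all
    let ?t = "sorted_list_of_set (set y)"
    have eq: "pull ?t x = y" using y'(2) pull_pack[of y] by simp
    have len: "length ?t = wmax x" using y'(2) wmax_pack[of y] by simp
    have "pull (map proj ?t) x = pull z x"
      unfolding map_pull[OF assms(2) len, symmetric] eq by (rule y'(3))
    then have "map proj ?t = z"
      by (rule pull_inject[OF assms(2) _ assms(3), rotated]) (simp only: length_map len)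
    then have "?t \<in> ?T" using y'(1) by simp
    then show "y \<in> (\<lambda>t. pull t x) ` ?T" by (rule image_eqI[rotated]) (rule eq[symmetric])
  next
    fix y assume "y \<in> (\<lambda>t. pull t x) ` ?T"
    then obtain t where t: "y = pull t x" "sorted_wrt (<) t" "set t \<subseteq> set L" "map proj t = z" by blast
    then have len: "length t = wmax x" using assms(3) by (metis length_map)
    show "y \<in> {y. set y \<subseteq> set L \<and> pack y = x \<and> map proj y = pull z x}"
      using t(3) by (simp add: t(1) set_pull[OF assms(2) len] pack_pull[OF assms(2) len t(2)]
        map_pull[OF assms(2) len] t(4))
  qed
  have len: "length t = wmax x" if "t \<in> ?T" for t
  proof -
    have "map proj t = z" using that by blast
    then show ?thesis unfolding assms(3)[symmetric] by (rule subst) simp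
  qed
  have inj: "inj_on (\<lambda>t. pull t x) ?T"
    by (rule inj_onI) (rule pull_inject[OF assms(2) len len])
  show ?thesis
    unfolding im subset_series_eq_card[OF assms(1)] card_image[OF inj] by (rule refl)
qed

lemma card_words_pack_eq:
  assumes "s \<in> packed_words n"
  shows "card {f. length f = n \<and> set f \<subseteq> {1..m} \<and> pack f = s} = m choose wmax s"
proof -
  \<comment> \<open>Projection to the one-element type forgets everything but the length.\<close>
  have "{f. length f = n \<and> set f \<subseteq> {1..m} \<and> pack f = s}
      = {y. set y \<subseteq> set [1..<Suc m] \<and> pack y = s \<and> map (\<lambda>_. ()) y = pull (replicate (wmax s) ()) s}"
  proof -
    have "map (\<lambda>_. ()) y = pull (replicate (wmax s) ()) s \<longleftrightarrow> length y = n" for y :: "nat list"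
      using assms by (auto simp: packed_words_def pull_def map_replicate_const)
    then show ?thesis by (auto simp: atLeastLessThanSuc_atLeastAtMost simp del: upt_Suc)
  qed
  then have "of_nat (card {f. length f = n \<and> set f \<subseteq> {1..m} \<and> pack f = s}) =
      (subset_series (map (\<lambda>_. ()) [1..<Suc m]) (replicate (wmax s) ()) :: int)"
    using assms card_pack_eq[of "[1..<Suc m]" s "replicate (wmax s) ()" "\<lambda>_. ()"]
    by (simp add: packed_words_def del: upt_Suc)
  also have "\<dots> = of_nat (m choose wmax s)"
    using subset_series_replicate[of m "()" "wmax s", where 'a = int] by (simp add: map_replicate_const del: upt_Suc)
  finally show ?thesis by simp
qed

text \<open>At \<open>t = m\<close> the weight of \<open>s\<close> is the number of words over
  \<open>{1..m}\<close> that pack to \<open>s\<close>.\<close>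

lemma sum_poly_tbinom_eq_card:
  "(\<Sum>s\<in>packed_words n. if Q s then poly (tbinom (wmax s)) (of_nat m) else 0) =
    (of_nat (card {f. length f = n \<and> set f \<subseteq> {1..m} \<and> Q (pack f)}) :: 'a::field_char_0)"
proof -
  let ?A = "\<lambda>s. {f. length f = n \<and> set f \<subseteq> {1..m} \<and> pack f = s}"
  let ?P = "{s \<in> packed_words n. Q s}"
  have "{f. length f = n \<and> set f \<subseteq> {1..m} \<and> Q (pack f)} = (\<Union>s\<in>?P. ?A s)"
    using packed_pack by (auto simp: packed_words_def)
  moreover have "finite (?A s)" for s
    by (rule finite_subset[OF _ finite_lists_length_eq[of "{1..m}" n]]) auto
  ultimately have "card {f. length f = n \<and> set f \<subseteq> {1..m} \<and> Q (pack f)} = (\<Sum>s\<in>?P. card (?A s))"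
    using finite_packed_words[of n] by (simp only: card_UN_disjoint) (subst card_UN_disjoint, auto)
  also have "\<dots> = (\<Sum>s\<in>?P. m choose wmax s)"
    by (intro sum.cong refl card_words_pack_eq) simp
  finally show ?thesis
    using finite_packed_words[of n]
    by (auto simp: poly_tbinom binomial_gbinomial[symmetric] sum.inter_filter intro!: sum.cong)
qed

section \<open>Coefficients of the internal product\<close>

lemma lookup_scale [simp]: "Poly_Mapping.lookup (scale c f) x = c * Poly_Mapping.lookup f x"
  by (simp add: scale_def map.rep_eq when_def)

lemma lookup_basis_N:
  "Poly_Mapping.lookup (basis_N u) x = (if u = x then 1 else 0)"
  by (simp add: basis_N_def lookup_single when_def)

lemma keys_basis_N: "Poly_Mapping.keys (basis_N u) \<subseteq> {u}"
  by (auto simp: in_keys_iff lookup_basis_N split: if_splits)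

lemma lookup_internal_prod:
  assumes "finite A" "Poly_Mapping.keys f \<subseteq> A" "finite B" "Poly_Mapping.keys g \<subseteq> B"
  shows "Poly_Mapping.lookup (f \<star> g) x = (\<Sum>u\<in>A. \<Sum>v\<in>B.
    Poly_Mapping.lookup f u * Poly_Mapping.lookup g v * Poly_Mapping.lookup (basis_prod u v) x)"
proof -
  let ?t = "\<lambda>u v. Poly_Mapping.lookup f u * Poly_Mapping.lookup g v * Poly_Mapping.lookup (basis_prod u v) x"
  have "Poly_Mapping.lookup (f \<star> g) x = (\<Sum>u\<in>Poly_Mapping.keys f. \<Sum>v\<in>Poly_Mapping.keys g. ?t u v)"
    by (simp add: internal_prod_def lookup_sum)
  also have "\<dots> = (\<Sum>u\<in>Poly_Mapping.keys f. \<Sum>v\<in>B. ?t u v)"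
    by (intro sum.cong refl sum.mono_neutral_left) (use assms in \<open>auto simp: in_keys_iff\<close>)
  also have "\<dots> = (\<Sum>u\<in>A. \<Sum>v\<in>B. ?t u v)"
    by (intro sum.mono_neutral_left) (use assms in \<open>auto simp: in_keys_iff\<close>)
  finally show ?thesis .
qed

lemma lookup_basis_N_prod:
  assumes "Poly_Mapping.keys g \<subseteq> packed_words (length u)"
  shows "Poly_Mapping.lookup (basis_N u \<star> g) x =
    (\<Sum>s\<in>packed_words (length u). if pack (zip u s) = x then Poly_Mapping.lookup g s else 0)"
  by (subst lookup_internal_prod[OF _ keys_basis_N finite_packed_words assms])
     (auto simp: lookup_basis_N basis_prod_def packed_words_def intro!: sum.cong)

lemma lookup_prod_basis_N:
  assumes "Poly_Mapping.keys f \<subseteq> packed_words (length v)"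
  shows "Poly_Mapping.lookup (f \<star> basis_N v) x =
    (\<Sum>s\<in>packed_words (length v). if pack (zip s v) = x then Poly_Mapping.lookup f s else 0)"
  by (subst lookup_internal_prod[OF finite_packed_words assms _ keys_basis_N])
     (auto simp: lookup_basis_N basis_prod_def packed_words_def intro!: sum.cong)

lemma keys_sigma: "Poly_Mapping.keys (sigma n) \<subseteq> packed_words n"
  by (auto simp: in_keys_iff lookup_sigma split: if_splits)

lemma keys_E_coeff: "Poly_Mapping.keys (E_coeff n k) \<subseteq> packed_words n"
  by (auto simp: in_keys_iff lookup_E split: if_splits)

text \<open>Only \<open>\<le>\<close> is used on the right, so that \<open>pack_le_iff\<close> can
  rewrite each component.\<close>

lemma pair_le_iff: "(a, b) \<le> (c, d) \<longleftrightarrow> \<not> c \<le> a \<or> a \<le> c \<and> b \<le> d"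
  for a c :: "'a::linorder" and b d :: "'b::linorder"
  by auto

lemma pack_zip_pack_left:
  assumes "length y = length v"
  shows "pack (zip (pack y) v) = pack (zip y v)"
  using assms by (intro pack_eqI) (simp_all add: pair_le_iff pack_le_iff del: less_eq_prod_simp)

lemma pack_zip_pack_right:
  assumes "length u = length y"
  shows "pack (zip u (pack y)) = pack (zip u y)"
  using assms by (intro pack_eqI) (simp_all add: pair_le_iff pack_le_iff del: less_eq_prod_simp)

section \<open>Coefficients of the triple product and of \<open>basis_K\<close>\<close>

lemma lookup_basis_K:
  "Poly_Mapping.lookup (basis_K w) x =
    coeff (\<Sum>s\<in>packed_words (length w). if pack (zip w s) = x then tbinom (wmax s) else 0) (wmax w)"
  by (auto simp: basis_K_def lookup_basis_N_prod keys_E_coeff coeff_sum lookup_E intro!: sum.cong)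

lemma lookup_N_sigma_N:
  assumes "length v = length u"
  shows "Poly_Mapping.lookup (basis_N u \<star> sigma (length u) \<star> basis_N v) x =
    (\<Sum>s\<in>packed_words (length u). if pack (zip (zip u s) v) = x then tbinom (wmax s) else 0 :: 'a::field_char_0 poly)"
proof -
  let ?P = "packed_words (length u)"
  have inner: "Poly_Mapping.lookup (basis_N u \<star> sigma (length u)) a =
      (\<Sum>s\<in>?P. if pack (zip u s) = a then tbinom (wmax s) else 0 :: 'a poly)" for a
    by (subst lookup_basis_N_prod) (auto simp: keys_sigma lookup_sigma intro!: sum.cong)
  have packs: "pack (zip u s) \<in> ?P" if "s \<in> ?P" for s
    using that packed_pack by (simp add: packed_words_def)
  have "Poly_Mapping.keys (basis_N u \<star> sigma (length u) :: _ \<Rightarrow>\<^sub>0 'a poly) \<subseteq> ?P"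
    using packs by (auto simp: in_keys_iff inner elim!: sum.not_neutral_contains_not_neutral split: if_splits)
  then have "Poly_Mapping.lookup (basis_N u \<star> sigma (length u) \<star> basis_N v) x =
      (\<Sum>a\<in>?P. if pack (zip a v) = x then \<Sum>s\<in>?P. if pack (zip u s) = a then tbinom (wmax s) else 0 :: 'a poly else 0)"
    using assms by (auto simp: lookup_prod_basis_N inner intro!: sum.cong)
  also have "\<dots> = (\<Sum>a\<in>?P. \<Sum>s\<in>?P. if a = pack (zip u s) then
      if pack (zip a v) = x then tbinom (wmax s) else 0 else 0)"
    by (intro sum.cong) (auto intro!: sum.cong sum.neutral)
  also have "\<dots> = (\<Sum>s\<in>?P. \<Sum>a\<in>?P. if a = pack (zip u s) then
      if pack (zip a v) = x then tbinom (wmax s) else 0 else 0)"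
    by (rule sum.swap)
  also have "\<dots> = (\<Sum>s\<in>?P. if pack (zip (pack (zip u s)) v) = x then tbinom (wmax s) else 0)"
    using packs by (simp add: finite_packed_words)
  also have "\<dots> = (\<Sum>s\<in>?P. if pack (zip (zip u s) v) = x then tbinom (wmax s) else 0)"
    using assms by (intro sum.cong) (auto simp: pack_zip_pack_left packed_words_def)
  finally show ?thesis .
qed

lemma poly_lookup_N_sigma_N:
  assumes "length v = length u"
  shows "poly (Poly_Mapping.lookup (basis_N u \<star> sigma (length u) \<star> basis_N v) x) (of_nat m) =
    (of_nat (card {f. length f = length u \<and> set f \<subseteq> {1..m} \<and> pack (zip (zip u f) v) = x}) :: 'a::field_char_0)"
proof -
  have "pack (zip (zip u (pack f)) v) = pack (zip (zip u f) v)" if "length f = length u" for f :: "nat list"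
    using that assms pack_zip_pack_left[of "zip u (pack f)" v] pack_zip_pack_left[of "zip u f" v]
    by (simp add: pack_zip_pack_right)
  then have *: "{f. length f = length u \<and> set f \<subseteq> {1..m} \<and> pack (zip (zip u f) v) = x} =
      {f. length f = length u \<and> set f \<subseteq> {1..m} \<and> pack (zip (zip u (pack f)) v) = x}"
    by auto
  show ?thesis
    unfolding * lookup_N_sigma_N[OF assms] poly_sum
      sum_poly_tbinom_eq_card[symmetric, where Q = "\<lambda>s. pack (zip (zip u s) v) = x"]
    by (intro sum.cong) auto
qed

text \<open>Every term of \<open>basis_K w\<close> packs a word of biletters with top row
  \<open>w\<close>, and the top letter has priority in the order.\<close>

lemma finer_of_lookup_basis_K:
  assumes "Poly_Mapping.lookup (basis_K w) x \<noteq> 0"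
  shows "packed x" "finer x w"
proof -
  from assms obtain s where s: "s \<in> packed_words (length w)" "x = pack (zip w s)"
    by (auto simp: lookup_basis_K coeff_sum elim!: sum.not_neutral_contains_not_neutral split: if_splits)
  then show "packed x" by (simp add: packed_pack)
  show "finer x w"
    using s by (auto simp: finer_def packed_words_def pack_le_iff pair_le_iff simp del: less_eq_prod_simp)
qed

text \<open>The factor for \<open>i = 0\<close> is \<open>t\<close> itself; the remaining factors
  are evaluated at 0.\<close>

lemma tbinom_eq_log_coeff:
  assumes "k > 0"
  shows "\<exists>q :: 'a::field_char_0 poly. tbinom k = [:0, 1:] * q \<and> poly q 0 = log_coeff k"
proof -
  obtain j where k: "k = Suc j" using assms by (cases k) auto
  let ?q = "smult (inverse (fact k)) (\<Prod>i<j. [:- of_nat (Suc i), 1:]) :: 'a poly"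
  have "tbinom k = [:0, 1:] * ?q"
    unfolding tbinom_def k prod.lessThan_Suc_shift by (simp del: prod.lessThan_Suc)
  moreover have "(\<Prod>i<j. - of_nat (Suc i) :: 'a) = (-1) ^ j * fact j"
    by (induction j) (simp_all add: algebra_simps)
  then have "poly ?q 0 = log_coeff k"
    by (simp add: poly_prod k log_coeff_def fps_ln_nth field_simps del: of_nat_Suc)
  ultimately show ?thesis by blast
qed

text \<open>Each factor is divisible by \<open>t\<close>, so the coefficient of
  \<open>t ^ card B\<close> is the product of the linear coefficients. This is how the component of
  \<open>sigma\<close> chosen in \<open>basis_K\<close> produces logarithms.\<close>

lemma coeff_prod_tbinom:
  assumes "finite B" "\<And>b. b \<in> B \<Longrightarrow> k b > 0"
  shows "coeff (\<Prod>b\<in>B. tbinom (k b) :: 'a::field_char_0 poly) (card B) = (\<Prod>b\<in>B. log_coeff (k b))"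
proof -
  have "\<forall>b\<in>B. \<exists>q :: 'a poly. tbinom (k b) = [:0, 1:] * q \<and> poly q 0 = log_coeff (k b)"
    using assms(2) tbinom_eq_log_coeff by blast
  then obtain q :: "'b \<Rightarrow> 'a poly"
    where q: "\<And>b. b \<in> B \<Longrightarrow> tbinom (k b) = [:0, 1:] * q b \<and> poly (q b) 0 = log_coeff (k b)"
    by metis
  have "(\<Prod>b\<in>B. tbinom (k b)) = (\<Prod>b\<in>B. [:0, 1:] * q b)"
    by (intro prod.cong) (use q in auto)
  also have "\<dots> = monom 1 (card B) * (\<Prod>b\<in>B. q b)"
    by (simp only: prod.distrib prod_constant) (simp add: monom_altdef)
  finally show ?thesis
    using q by (simp add: coeff_monom_mult poly_0_coeff_0[symmetric] poly_prod)
qed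

lemma poly_eqI_of_nat:
  fixes p q :: "'a::field_char_0 poly"
  assumes "\<And>m :: nat. poly p (of_nat m) = poly q (of_nat m)"
  shows "p = q"
proof (rule ccontr)
  assume "p \<noteq> q"
  then have "finite {x. poly (p - q) x = 0}" by (intro poly_roots_finite) simp
  moreover have "range of_nat \<subseteq> {x. poly (p - q) x = 0}" using assms by auto
  ultimately have "finite (range (of_nat :: nat \<Rightarrow> 'a))" by (rule finite_subset[rotated])
  then show False by (simp add: finite_image_iff inj_of_nat)
qed

text \<open>Here \<open>W\<close> sends each block of \<open>x\<close> to the block of
  \<open>pull W x\<close> containing it, and \<open>k b\<close> blocks go into block
  \<open>b\<close>. At \<open>t = m\<close> the sum counts the choices of \<open>k b\<close>
  increasing values in \<open>{1..m}\<close> for each \<open>b\<close>; the product of binomials so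
  obtained has the stated coefficient at \<open>t ^ M\<close>.\<close>

lemma lookup_basis_K_pull:
  assumes x: "packed x" and W: "W = concat (map (\<lambda>b. replicate (k b) b) [1..<Suc M])"
    and len: "length W = wmax x" and k: "\<And>b. 1 \<le> b \<Longrightarrow> b \<le> M \<Longrightarrow> 0 < k b"
  shows "Poly_Mapping.lookup (basis_K (pull W x)) x = (\<Prod>b=1..M. log_coeff (k b) :: 'a::field_char_0)"
proof -
  let ?w = "pull W x"
  let ?p = "\<Sum>s\<in>packed_words (length ?w). if pack (zip ?w s) = x then tbinom (wmax s) else 0 :: 'a poly"
  have set_W: "set W = {1..M}" using k by (auto simp: W simp del: upt_Suc)
  then have "set ?w = {1..M}" using set_pull[OF x len] by simp
  then have wmax: "wmax ?w = M" by (metis packed_def set_packed card_atLeastAtMost diff_Suc_1)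
  have "?p = (\<Prod>b=1..M. tbinom (k b))"
  proof (rule poly_eqI_of_nat)
    fix m
    let ?L = "concat (map (\<lambda>b. map (Pair b) [1..<Suc m]) [1..<Suc M])"
    let ?F = "{f. length f = length ?w \<and> set f \<subseteq> {1..m} \<and> pack (zip ?w f) = x}"
    have L: "sorted_wrt (<) ?L"
      by (rule sorted_wrt_concat_map) (auto simp: sorted_wrt_map simp del: upt_Suc)
    have "{y. set y \<subseteq> set ?L \<and> pack y = x \<and> map fst y = ?w} = zip ?w ` ?F" (is "?Y = _")
    proof (intro subset_antisym subsetI)
      fix y assume y: "y \<in> ?Y"
      then have y': "set y \<subseteq> set ?L" "pack y = x" "?w = map fst y" by simp_all
      have "y = zip ?w (map snd y)" unfolding y'(3) by (rule zip_map_fst_snd[symmetric])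
      moreover have "length (map snd y) = length ?w" unfolding y'(3) by simp
      moreover have "set (map snd y) \<subseteq> {1..m}" using y'(1) by (fastforce simp del: upt_Suc)
      ultimately have "map snd y \<in> ?F" using y'(2) by simp
      moreover note \<open>y = zip ?w (map snd y)\<close>
      ultimately show "y \<in> zip ?w ` ?F" by blast
    next
      fix y assume "y \<in> zip ?w ` ?F"
      then obtain f where f: "y = zip ?w f" "length f = length ?w" "set f \<subseteq> {1..m}" "pack y = x" by auto
      have "set y \<subseteq> {1..M} \<times> {1..m}"
        using f(3) \<open>set ?w = {1..M}\<close> unfolding f(1) by (auto dest: set_zip_leftD set_zip_rightD)
      moreover have "set ?L = {1..M} \<times> {1..m}" by (auto simp: image_iff simp del: upt_Suc)
      ultimately show "y \<in> ?Y" using f by simp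
    qed
    moreover have "inj_on (zip ?w) ?F"
      by (rule inj_onI) (metis (mono_tags, lifting) map_snd_zip mem_Collect_eq)
    ultimately have "of_nat (card ?F) = (subset_series (map fst ?L) W :: 'a)"
      using card_pack_eq[OF L x len, of fst] by (simp add: card_image)
    also have "map fst ?L = concat (map (\<lambda>b. replicate m b) [1..<Suc M])"
      by (simp add: map_concat o_def map_replicate_const del: upt_Suc)
    \<comment> \<open>The product splits because different \<open>b\<close> use disjoint alphabets
      \<open>{b}\<close>.\<close>
    also have "subset_series \<dots> W = (\<Prod>b\<in>set [1..<Suc M]. subset_series (replicate m b) (replicate (k b) b))"
      unfolding W by (rule prod_series_concat[where A = "\<lambda>b. {b}"]) auto
    also have "\<dots> = poly (\<Prod>b=1..M. tbinom (k b)) (of_nat m)"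
      by (simp add: poly_prod subset_series_replicate poly_tbinom binomial_gbinomial
          atLeastLessThanSuc_atLeastAtMost del: upt_Suc)
    finally have "of_nat (card ?F) = poly (\<Prod>b=1..M. tbinom (k b)) (of_nat m :: 'a)" .
    moreover have F: "{f. length f = length ?w \<and> set f \<subseteq> {1..m} \<and> pack (zip ?w (pack f)) = x} = ?F"
      by (auto simp: pack_zip_pack_right)
    have "poly ?p (of_nat m) = of_nat (card ?F)"
      unfolding poly_sum F[symmetric]
        sum_poly_tbinom_eq_card[symmetric, where Q = "\<lambda>s. pack (zip ?w s) = x"]
      by (intro sum.cong) auto
    ultimately show "poly ?p (of_nat m) = poly (\<Prod>b=1..M. tbinom (k b)) (of_nat m)" by simp
  qed
  then show ?thesis
    unfolding lookup_basis_K wmax using coeff_prod_tbinom[of "{1..M}" k, where 'a = 'a] k by simp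
qed

section \<open>Coarsenings as run decompositions\<close>

text \<open>The head has the least key, so the groups before its own are empty and it comes first in
  its own group.\<close>

lemma concat_filter_sorted:
  assumes "sorted (map f l)" "\<And>q. q \<in> set l \<Longrightarrow> a \<le> f q \<and> f q < b"
  shows "concat (map (\<lambda>i. filter (\<lambda>q. f q = i) l) [a..<b]) = l"
  using assms
proof (induction l)
  case (Cons q l)
  let ?c = "\<lambda>l is. concat (map (\<lambda>i. filter (\<lambda>q. f q = i) l) is)"
  have q: "a \<le> f q" "f q < b" using Cons.prems(2) by auto
  then have "[a..<b] = [a..<f q] @ [f q..<b]"
    using upt_add_eq_append[of a "f q" "b - f q"] by simp
  then have split: "[a..<b] = [a..<f q] @ f q # [Suc (f q)..<b]"
    using q by (simp add: upt_conv_Cons)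
  have low: "?c (q # l) [a..<f q] = []" "?c l [a..<f q] = []"
    using Cons.prems(1) by (auto simp: filter_empty_conv)
  have high: "?c (q # l) [Suc (f q)..<b] = ?c l [Suc (f q)..<b]"
    by (intro arg_cong[of _ _ concat] map_cong) auto
  have "?c (q # l) [a..<b] = q # ?c l [a..<b]"
    unfolding split map_append concat_append list.map concat.simps low high by simp
  also have "?c l [a..<b] = l" using Cons by simp
  finally show ?case .
qed (simp add: concat_eq_Nil_conv)

lemma map_nth_pred_upt: "map (\<lambda>b. xs ! (b - 1)) [1..<Suc (length xs)] = xs"
  by (rule nth_equalityI) (auto simp del: upt_Suc)

text \<open>Each position receives the number, counted from 1, of its run. If \<open>bs\<close>
  decomposes the word carried by the blocks of \<open>x\<close>, then
  \<open>pull (run_labels bs) x\<close> merges the blocks lying in a common run.\<close>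

definition run_labels :: "('l \<times> nat) list \<Rightarrow> nat list" where
  "run_labels bs = concat (map (\<lambda>b. replicate (snd (bs ! (b - 1))) b) [1..<Suc (length bs)])"

lemma pull_run_labels: "pull (map fst bs) (run_labels bs) = expand bs"
proof -
  have "pull (map fst bs) (run_labels bs)
      = concat (map (\<lambda>b. replicate (snd (bs ! (b - 1))) (map fst bs ! (b - 1))) [1..<Suc (length bs)])"
    by (simp add: pull_def run_labels_def map_concat o_def del: upt_Suc)
  also have "\<dots> = concat (map ((\<lambda>q. replicate (snd q) (fst q)) \<circ> (\<lambda>b. bs ! (b - 1))) [1..<Suc (length bs)])"
    by (intro arg_cong[of _ _ concat] map_cong) (auto simp del: upt_Suc)
  also have "\<dots> = expand bs"
    unfolding map_map[symmetric] map_nth_pred_upt expand_def ..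
  finally show ?thesis .
qed

lemma sorted_run_labels: "sorted (run_labels bs)"
  unfolding run_labels_def by (rule sorted_wrt_concat_map) (auto simp del: upt_Suc)

lemma set_run_labels:
  assumes "\<forall>q\<in>set bs. 0 < snd q"
  shows "set (run_labels bs) = {1..length bs}"
proof -
  have "snd (bs ! (b - 1)) \<noteq> 0" if "1 \<le> b" "b \<le> length bs" for b
    using assms that nth_mem[of "b - 1" bs] by auto
  then show ?thesis by (auto simp: run_labels_def simp del: upt_Suc)
qed

lemma packed_wmax:
  assumes "set w = {1..M}"
  shows "packed w" "wmax w = M"
proof -
  show *: "packed w" using assms by (auto simp: packed_def)
  show "wmax w = M" using set_packed[OF *] assms by (metis card_atLeastAtMost diff_Suc_1)
qed

lemma count_list_run_labels:
  assumes "1 \<le> b" "b \<le> length bs"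
  shows "count_list (run_labels bs) b = snd (bs ! (b - 1))"
proof -
  have "count_list (run_labels bs) b
      = sum_list (map (\<lambda>c. if c = b then snd (bs ! (b - 1)) else 0) [1..<Suc (length bs)])"
    unfolding run_labels_def count_list_concat map_map
    by (intro arg_cong[of _ _ sum_list] map_cong) (auto simp: count_list_0_iff count_list_eq_length_filter)
  also have "\<dots> = snd (bs ! (b - 1))"
    using assms by (auto simp: sum_list_distinct_conv_sum_set simp del: upt_Suc)
  finally show ?thesis .
qed

text \<open>Counting labels gives the run lengths; the labels and \<open>z\<close> together give the
  letters of the runs.\<close>

lemma run_labels_inject:
  assumes "bs \<in> run_decomps z" "bs' \<in> run_decomps z" "run_labels bs = run_labels bs'"
  shows "bs = bs'"
proof -
  have pos: "\<forall>q\<in>set bs. 0 < snd q" "\<forall>q\<in>set bs'. 0 < snd q" and z: "expand bs = expand bs'"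
    using assms by (auto simp: run_decomps_def)
  have "{1..length bs} = {1..length bs'}"
    by (simp only: set_run_labels[OF pos(1), symmetric] set_run_labels[OF pos(2), symmetric] assms(3))
  then have len: "length bs = length bs'" by (metis card_atLeastAtMost diff_Suc_1)
  have "map snd bs = map snd bs'"
  proof (rule nth_equalityI)
    fix i assume "i < length (map snd bs)"
    then show "map snd bs ! i = map snd bs' ! i"
      using count_list_run_labels[of "Suc i" bs] count_list_run_labels[of "Suc i" bs'] len assms(3) by simp
  qed (simp add: len)
  moreover have "map fst bs = map fst bs'"
  proof (rule pull_inject)
    show "packed (run_labels bs)" by (rule packed_wmax[OF set_run_labels[OF pos(1)]])
    show "length (map fst bs) = wmax (run_labels bs)" "length (map fst bs') = wmax (run_labels bs)"
      using packed_wmax(2)[OF set_run_labels[OF pos(1)]] len by simp_all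
    show "pull (map fst bs) (run_labels bs) = pull (map fst bs') (run_labels bs)"
      using z pull_run_labels[of bs] pull_run_labels[of bs'] assms(3) by simp
  qed
  ultimately show ?thesis by (metis zip_map_fst_snd)
qed

text \<open>A coarsening of \<open>x\<close> merges consecutive blocks. It lies in
  \<open>W_set u v\<close> exactly when the pair of letters of \<open>u\<close> and \<open>v\<close>
  is constant on every merged block, that is, when the merged blocks form runs of equal letters of
  \<open>z\<close>.\<close>

lemma bij_betw_run_decomps:
  assumes x: "packed x" "finer x u" and z: "length z = wmax x" "pull z x = zip u v"
    and len: "length u = length v"
  shows "bij_betw (\<lambda>bs. pull (run_labels bs) x) (run_decomps z) {w \<in> W_set u v. finer x w}"
  unfolding bij_betw_def
proof (intro conjI subset_antisym subsetI)
  have lx: "length x = length u" using x(2) by (simp add: finer_def)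
  have labels_length: "length (run_labels bs) = wmax x" if "bs \<in> run_decomps z" for bs
    using that pull_run_labels[of bs] length_pull[of "map fst bs" "run_labels bs"] z(1)
    by (simp add: run_decomps_def)
  show "inj_on (\<lambda>bs. pull (run_labels bs) x) (run_decomps z)"
    by (meson inj_onI run_labels_inject pull_inject x(1) labels_length)
  fix w
  {
    assume "w \<in> (\<lambda>bs. pull (run_labels bs) x) ` run_decomps z"
    then obtain bs where bs: "bs \<in> run_decomps z" and w: "w = pull (run_labels bs) x" by blast
    have pos: "\<forall>q\<in>set bs. 0 < snd q" and ex: "expand bs = z" using bs by (auto simp: run_decomps_def)
    have lab: "w ! i \<le> w ! j" if "x ! i \<le> x ! j" "i < length x" "j < length x" for i j
      unfolding w using that nth_packed[OF x(1), of j] nth_packed[OF x(1), of i] labels_length[OF bs]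
      by (auto simp: nth_pull intro!: sorted_nth_mono[OF sorted_run_labels])
    have "pull (map fst bs) w = zip u v"
      unfolding w pull_pull[OF x(1) labels_length[OF bs]] pull_run_labels ex by (rule z(2))
    then have uv: "(u ! i, v ! i) = map fst bs ! (w ! i - 1)" if "i < length x" for i
      using that lx len nth_pull[of i w "map fst bs"] by (simp add: w)
    have uv_eq: "u ! i = u ! j \<and> v ! i = v ! j" if "w ! i = w ! j" "i < length x" "j < length x" for i j
      using uv[OF that(2)] uv[OF that(3)] unfolding that(1) by (metis prod.inject)
    have "set w = {1..length bs}"
      unfolding w set_pull[OF x(1) labels_length[OF bs]] by (rule set_run_labels[OF pos])
    then have "packed w" by (rule packed_wmax)
    have lw: "length w = length x" by (simp add: w)
    have mono: "u ! i \<le> u ! j" if ij: "w ! i \<le> w ! j" "i < length x" "j < length x" for i j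
    proof (cases "w ! i = w ! j")
      case True
      then show ?thesis using uv_eq[OF _ ij(2,3)] by simp
    next
      case False
      \<comment> \<open>Otherwise \<open>lab\<close> would give \<open>w ! j \<le> w ! i\<close>,
        hence equality.\<close>
      then have "x ! i \<le> x ! j" using lab[of j i] ij by force
      then show ?thesis using x(2) ij lx by (auto simp: finer_def)
    qed
    have "finer w u"
      unfolding finer_def using mono lw lx by simp
    moreover have "weakly_finer w v"
      unfolding weakly_finer_def using uv_eq lw lx len by metis
    ultimately have "w \<in> W_set u v"
      using \<open>packed w\<close> lw lx by (simp add: W_set_def)
    moreover have "finer x w" using lab lw by (simp add: finer_def)
    ultimately show "w \<in> {w \<in> W_set u v. finer x w}" by simp
  next
    assume "w \<in> {w \<in> W_set u v. finer x w}"
    then have w: "packed w" "length w = length x" "finer w u" "weakly_finer w v" "finer x w"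
      using lx by (auto simp: W_set_def)
    have eq: "w ! i = w ! j" if "i < length x" "j < length x" "x ! i = x ! j" for i j
      using w(5) w(2) that unfolding finer_def by (metis order.antisym order.refl)
    \<comment> \<open>\<open>W\<close> gives the block of \<open>w\<close> that contains a block of
      \<open>x\<close>; \<open>l\<close> below gives the pair carried by a block of
      \<open>w\<close>.\<close>
    obtain W where W: "length W = wmax x" "pull W x = w"
      using exists_pull[OF x(1) w(2) eq] by blast
    have eq': "zip u v ! i = zip u v ! j" if "i < length w" "j < length w" "w ! i = w ! j" for i j
    proof -
      have "u ! i = u ! j" using w(2,3) lx that unfolding finer_def by (metis order.antisym order.refl)
      moreover have "v ! i = v ! j" using w(2,4) lx len that unfolding weakly_finer_def by metis
      ultimately show ?thesis using that w(2) lx len by simp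
    qed
    have "length (zip u v) = length w" using lx len w(2) by simp
    then obtain l where l: "length l = wmax w" "pull l w = zip u v"
      using exists_pull[OF w(1) _ eq'] by blast
    have "pull (pull l W) x = pull z x"
      using pull_pull[OF x(1) W(1), of l] W(2) l(2) z(2) by simp
    then have lW: "pull l W = z"
      using W(1) z(1) by (intro pull_inject[OF x(1), of "pull l W" z]) simp_all
    have set_W: "set W = {1..wmax w}"
      using set_pull[OF x(1) W(1)] set_packed[OF w(1)] W(2) by simp
    have "sorted W"
      unfolding sorted_iff_nth_mono
    proof (intro allI impI)
      fix a b assume ab: "a \<le> b" "b < length W"
      then have "Suc a \<in> set x" "Suc b \<in> set x" using set_packed[OF x(1)] W(1) by auto
      then obtain i j where ij: "i < length x" "x ! i = Suc a" "j < length x" "x ! j = Suc b"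
        by (auto simp: in_set_conv_nth)
      then have "w ! i \<le> w ! j" using w(2,5) ab by (auto simp: finer_def)
      then show "W ! a \<le> W ! b" using ij nth_pull[of i x W] nth_pull[of j x W] W(2) by simp
    qed
    \<comment> \<open>Run \<open>b\<close> carries the pair of block \<open>b\<close> of
      \<open>w\<close>; its length is the number of blocks of \<open>x\<close> merged into that
      block.\<close>
    define bs where "bs = map (\<lambda>b. (l ! (b - 1), count_list W b)) [1..<Suc (wmax w)]"
    have len_bs: "length bs = wmax w" by (simp add: bs_def del: upt_Suc)
    have fst_bs: "map fst bs = l"
      using map_nth_pred_upt[of l] l(1) by (simp add: bs_def o_def del: upt_Suc)
    have "run_labels bs = concat (map (\<lambda>b. replicate (count_list W b) b) [1..<Suc (wmax w)])"
      unfolding run_labels_def len_bs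
      by (intro arg_cong[of _ _ concat] map_cong) (auto simp: bs_def simp del: upt_Suc)
    also have "\<dots> = concat (map (\<lambda>i. filter (\<lambda>q. q = i) W) [1..<Suc (wmax w)])"
    proof -
      have "filter (\<lambda>q. q = b) W = replicate (count_list W b) b" for b
        by (induction W) auto
      then show ?thesis by simp
    qed
    also have "\<dots> = W"
      using \<open>sorted W\<close> set_W by (intro concat_filter_sorted) auto
    finally have labels: "run_labels bs = W" .
    have "expand bs = z"
      using pull_run_labels[of bs] unfolding fst_bs labels lW by simp
    moreover have "0 < snd q" if q: "q \<in> set bs" for q
    proof -
      obtain b where "q = (l ! (b - 1), count_list W b)" "b \<in> set W"
        using q set_W by (auto simp: bs_def simp del: upt_Suc)
      then show ?thesis by (simp add: count_list_0_iff zero_less_iff_neq_zero)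
    qed
    ultimately have "bs \<in> run_decomps z" by (simp add: run_decomps_def)
    then show "w \<in> (\<lambda>bs. pull (run_labels bs) x) ` run_decomps z"
      using labels W(2) by (intro image_eqI[of _ _ bs]) simp_all
  }
qed

lemma lookup_basis_K_run_labels:
  assumes "packed x" "bs \<in> run_decomps z" "length z = wmax x"
  shows "Poly_Mapping.lookup (basis_K (pull (run_labels bs) x)) x = (log_weight bs :: 'a::field_char_0)"
proof -
  have pos: "0 < snd (bs ! (b - 1))" if "1 \<le> b" "b \<le> length bs" for b
    using assms(2) nth_mem[of "b - 1" bs] that by (auto simp: run_decomps_def)
  have "length (run_labels bs) = wmax x"
    using assms pull_run_labels[of bs] length_pull[of "map fst bs" "run_labels bs"]
    by (simp add: run_decomps_def)
  then have "Poly_Mapping.lookup (basis_K (pull (run_labels bs) x)) x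
      = (\<Prod>b=1..length bs. log_coeff (snd (bs ! (b - 1))) :: 'a)"
    using pos by (intro lookup_basis_K_pull[OF assms(1) run_labels_def])
  also have "\<dots> = prod_list (map (\<lambda>b. log_coeff (snd (bs ! (b - 1)))) [1..<Suc (length bs)])"
    by (simp only: prod.distinct_set_conv_list[OF distinct_upt, symmetric]
        set_upt atLeastLessThanSuc_atLeastAtMost)
  also have "\<dots> = prod_list (map (\<lambda>q. log_coeff (snd q)) (map (\<lambda>b. bs ! (b - 1)) [1..<Suc (length bs)]))"
    by (simp add: o_def del: upt_Suc)
  also have "\<dots> = log_weight bs"
    unfolding map_nth_pred_upt log_weight_def ..
  finally show ?thesis .
qed

section \<open>Products of Goldberg coefficients\<close>

text \<open>Ranks determine letters, so the chosen position is immaterial and the letter of index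
  \<open>i\<close> is \<open>g\<close> at the \<open>i\<close>-th smallest letter of
  \<open>z\<close>.\<close>

lemma refinement_word_pack:
  fixes z :: "nat list"
  shows "refinement_word (map g z) (pack z) = map g (sorted_list_of_set (set z))"
proof -
  let ?r = "\<lambda>a. card {y \<in> set z. y \<le> a}"
  have inj: "inj_on ?r (set z)"
    by (intro strict_mono_on_imp_inj_on strict_mono_on_rank) simp
  have "map g z ! (SOME j. j < length z \<and> pack z ! j = ?r a) = g a" if a: "a \<in> set z" for a
  proof -
    define j where "j = (SOME j. j < length z \<and> pack z ! j = ?r a)"
    obtain i where i: "i < length z" "z ! i = a" using a by (auto simp: in_set_conv_nth)
    have j: "j < length z \<and> pack z ! j = ?r a"
      unfolding j_def by (rule someI[of _ i]) (use i in \<open>simp add: pack_def\<close>)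
    then have "?r (z ! j) = ?r a" by (auto simp: pack_def)
    then have "z ! j = a" by (rule inj_onD[OF inj _ _ a]) (simp add: j)
    then show ?thesis unfolding j_def[symmetric] using j by simp
  qed
  then show ?thesis
    unfolding refinement_word_def wmax_pack map_rank_sorted_list_of_set[OF finite_set, symmetric]
    by simp
qed

text \<open>The values of \<open>v\<close> before packing; \<open>restrict_word\<close> replaces
  them by their ranks in this set.\<close>

definition block_values :: "nat list \<Rightarrow> nat list \<Rightarrow> nat \<Rightarrow> nat set" where
  "block_values u v i = {v ! j |j. j < length u \<and> u ! j = i}"

lemma finite_block_values [simp]: "finite (block_values u v i)"
  by (simp add: block_values_def)

text \<open>Evaluated at \<open>t = m\<close>, the Goldberg coefficients of the words over block \<open>i\<close> are coefficients
  of the product of exponentials over \<open>m\<close> copies of the alphabet of pairs \<open>(i, a)\<close>.\<close>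

definition block_alphabet :: "nat list \<Rightarrow> nat list \<Rightarrow> nat \<Rightarrow> nat \<Rightarrow> (nat \<times> nat) list" where
  "block_alphabet u v m i = concat (replicate m (map (Pair i) (sorted_list_of_set (block_values u v i))))"

lemma set_block_alphabet: "set (block_alphabet u v m i) \<subseteq> {i} \<times> block_values u v i"
  by (auto simp: block_alphabet_def)

text \<open>The refinement word consists of the pairs of \<open>l\<close> with first component
  \<open>i\<close>, each replaced by the rank of its second component. Undoing the ranks turns
  \<open>m\<close> copies of the alphabet of ranks into \<open>block_alphabet\<close>.\<close>

lemma poly_goldberg_restrict:
  assumes w: "packed w" "length w = length u" and len: "length v = length u"
    and l: "length l = wmax w" "pull l w = zip u v"
  shows "poly (goldberg (refinement_word (restrict_word u i v) (restrict_word u i w))) (of_nat m) =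
    (prod_series (\<lambda>k. 1 / fact k) (block_alphabet u v m i) (filter (\<lambda>q. fst q = i) l) :: 'a::field_char_0)"
proof -
  let ?V = "block_values u v i" and ?P = "{j. j < length u \<and> u ! j = i}"
  let ?r = "\<lambda>q. card {y \<in> ?V. y \<le> snd q}" and ?f = "filter (\<lambda>q. fst q = i) l"
  let ?z = "nths w ?P"
  have set_l: "set l = set (zip u v)" using set_pull[OF w(1) l(1)] l(2) by simp
  have f: "set ?f \<subseteq> {i} \<times> ?V"
    using len by (force simp: set_l set_zip block_values_def)
  have uv: "u = map fst (pull l w)" "v = map snd (pull l w)"
    using len by (simp_all add: l(2))
  have v: "v = map (\<lambda>b. snd (l ! (b - 1))) w"
    by (subst uv(2)) (simp add: pull_def)
  have "set (nths v ?P) = ?V"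
    using len by (auto simp: set_nths block_values_def)
  then have "restrict_word u i v = map (\<lambda>b. ?r (l ! (b - 1))) ?z"
    by (simp add: restrict_word_def pack_def) (simp add: v nths_map o_def)
  then have "refinement_word (restrict_word u i v) (restrict_word u i w)
      = map (\<lambda>b. ?r (l ! (b - 1))) (sorted_list_of_set (set ?z))"
    by (simp add: restrict_word_def[of u i w] refinement_word_pack)
  \<comment> \<open>The letters of \<open>w\<close> at the positions of \<open>i\<close> in
    \<open>u\<close> are the blocks of \<open>w\<close> whose pair starts with
    \<open>i\<close>.\<close>
  also have "sorted_list_of_set (set ?z) = filter (\<lambda>b. fst (l ! (b - 1)) = i) [1..<Suc (wmax w)]"
  proof (rule strict_sorted_equal)
    have u: "u ! j = fst (l ! (w ! j - 1))" if "j < length w" for j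
      by (subst uv(1)) (use that in \<open>simp add: nth_pull\<close>)
    have "set ?z = {b \<in> set w. fst (l ! (b - 1)) = i}"
      using u w(2) by (auto simp: set_nths in_set_conv_nth)
    then show "set (sorted_list_of_set (set ?z)) = set (filter (\<lambda>b. fst (l ! (b - 1)) = i) [1..<Suc (wmax w)])"
      using set_packed[OF w(1)] by (auto simp del: upt_Suc)
  qed (simp_all add: sorted_wrt_filter del: upt_Suc)
  also have "map (\<lambda>b. ?r (l ! (b - 1))) \<dots>
      = map ?r (filter (\<lambda>q. fst q = i) (map (\<lambda>b. l ! (b - 1)) [1..<Suc (wmax w)]))"
    by (simp add: filter_map o_def del: upt_Suc)
  also have "map (\<lambda>b. l ! (b - 1)) [1..<Suc (wmax w)] = l"
    using map_nth_pred_upt[of l] l(1) by simp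
  finally have "poly (goldberg (refinement_word (restrict_word u i v) (restrict_word u i w))) (of_nat m)
      = (series_power g_series m (map ?r ?f) :: 'a)"
    by (simp add: goldberg_def poly_g_power_t)
  also have "\<dots> = prod_series (\<lambda>k. 1 / fact k) (concat (replicate m [1..<Suc (card ?V)])) (map ?r ?f)"
    by (rule series_power_g_series) (auto intro: card_mono)
  also have "concat (replicate m [1..<Suc (card ?V)]) = map ?r (block_alphabet u v m i)"
    using map_rank_sorted_list_of_set[of ?V]
    by (simp add: block_alphabet_def map_concat o_def del: upt_Suc)
  also have "prod_series (\<lambda>k. 1 / fact k) (map ?r (block_alphabet u v m i)) (map ?r ?f)
      = prod_series (\<lambda>k. 1 / fact k) (block_alphabet u v m i) ?f"
  proof (rule prod_series_map, rule inj_on_subset)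
    show "inj_on ?r ({i} \<times> ?V)"
      using strict_mono_on_imp_inj_on[OF strict_mono_on_rank[of ?V]] by (force simp: inj_on_def)
    show "set (block_alphabet u v m i) \<union> set ?f \<subseteq> {i} \<times> ?V"
      using f set_block_alphabet by blast
  qed
  finally show ?thesis .
qed

text \<open>Since \<open>w\<close> is finer than \<open>u\<close>, the first components increase
  weakly along \<open>l\<close>, so \<open>l\<close> is the concatenation of its parts over the
  letters of \<open>u\<close>, whose alphabets are disjoint.\<close>

lemma prod_poly_goldberg_restrict:
  assumes u: "packed u" and w: "w \<in> W_set u v" and len: "length v = length u"
    and l: "length l = wmax w" "pull l w = zip u v"
  shows "(\<Prod>i=1..wmax u. poly (goldberg (refinement_word (restrict_word u i v) (restrict_word u i w))) (of_nat m)) =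
    (prod_series (\<lambda>k. 1 / fact k) (concat (map (block_alphabet u v m) [1..<Suc (wmax u)])) l :: 'a::field_char_0)"
proof -
  have pw: "packed w" "length w = length u" and fin: "finer w u" using w by (auto simp: W_set_def)
  let ?f = "\<lambda>i. filter (\<lambda>q. fst q = i) l"
  have set_l: "set l = set (zip u v)" using set_pull[OF pw(1) l(1)] l(2) by simp
  have "concat (map ?f [1..<Suc (wmax u)]) = l"
  proof (rule concat_filter_sorted)
    have lu: "fst (l ! (w ! j - 1)) = u ! j" if "j < length u" for j
    proof -
      have "l ! (w ! j - 1) = zip u v ! j" using that pw(2) nth_pull[of j w l] by (simp only: l(2))
      then show ?thesis using that len by simp
    qed
    show "sorted (map fst l)"
      unfolding sorted_iff_nth_mono
    proof (intro allI impI)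
      fix a b assume ab: "a \<le> b" "b < length (map fst l)"
      then have "Suc a \<in> set w" "Suc b \<in> set w" using set_packed[OF pw(1)] l(1) by auto
      then obtain i j where ij: "i < length u" "w ! i = Suc a" "j < length u" "w ! j = Suc b"
        using pw(2) by (auto simp: in_set_conv_nth)
      then have "u ! i \<le> u ! j" using fin ab by (auto simp: finer_def)
      then show "map fst l ! a \<le> map fst l ! b" using ij ab lu[of i] lu[of j] by simp
    qed
    show "1 \<le> fst q \<and> fst q < Suc (wmax u)" if "q \<in> set l" for q
    proof -
      have "fst q \<in> set u" using that unfolding set_l by (metis prod.collapse set_zip_leftD)
      then show ?thesis using set_packed[OF u] by auto
    qed
  qed
  then have "prod_series (\<lambda>k. 1 / fact k) (concat (map (block_alphabet u v m) [1..<Suc (wmax u)])) l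
      = (\<Prod>i\<in>set [1..<Suc (wmax u)]. prod_series (\<lambda>k. 1 / fact k) (block_alphabet u v m i) (?f i) :: 'a)"
    using prod_series_concat[of "[1..<Suc (wmax u)]" "\<lambda>i. {i} \<times> UNIV" "block_alphabet u v m" ?f
        "\<lambda>k. 1 / fact k :: 'a"] set_block_alphabet
    by (fastforce simp del: upt_Suc)
  then show ?thesis
    by (simp add: poly_goldberg_restrict[OF pw len l] atLeastLessThanSuc_atLeastAtMost del: upt_Suc)
qed

lemma card_words_zip_pack_eq:
  assumes u: "packed u" and len: "length v = length u" and x: "packed x"
    and z: "length z = wmax x" "pull z x = zip u v"
  shows "of_nat (card {f. length f = length u \<and> set f \<subseteq> {1..m} \<and> pack (zip (zip u f) v) = x}) =
    (subset_series (concat (map (block_alphabet u v m) [1..<Suc (wmax u)])) z :: 'a::comm_ring_1)"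
proof -
  let ?S = "\<lambda>i. sorted_list_of_set (block_values u v i)"
  \<comment> \<open>In the order on triples \<open>c\<close> varies more slowly than
    \<open>a\<close>, so dropping \<open>c\<close> leaves \<open>m\<close> copies of the block
    values.\<close>
  let ?I = "\<lambda>i. concat (map (\<lambda>c. map (Pair (i, c)) (?S i)) [1..<Suc m])"
  let ?L = "concat (map ?I [1..<Suc (wmax u)])"
  let ?proj = "\<lambda>((i, c), a). (i, a)"
  let ?F = "{f. length f = length u \<and> set f \<subseteq> {1..m} \<and> pack (zip (zip u f) v) = x}"
  let ?Y = "{y. set y \<subseteq> set ?L \<and> pack y = x \<and> map ?proj y = pull z x}"
  have I: "sorted_wrt (<) (?I i)" for i
    by (rule sorted_wrt_concat_map) (auto simp: sorted_wrt_map simp del: upt_Suc)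
  have L: "sorted_wrt (<) ?L"
    by (rule sorted_wrt_concat_map[OF _ I]) (auto simp del: upt_Suc)
  have set_L: "set ?L = {((i, c), a). i \<in> {1..wmax u} \<and> c \<in> {1..m} \<and> a \<in> block_values u v i}"
    by (auto simp: image_iff simp del: upt_Suc)
  have "?Y = (\<lambda>f. zip (zip u f) v) ` ?F"
  proof (intro subset_antisym subsetI)
    fix y assume "y \<in> ?Y"
    then have y: "set y \<subseteq> set ?L" "pack y = x" "map ?proj y = zip u v" using z(2) by simp_all
    let ?f = "map (\<lambda>q. snd (fst q)) y"
    have ly: "length y = length u" using arg_cong[OF y(3), of length] len by simp
    have "y = zip (zip u ?f) v"
    proof (rule nth_equalityI)
      fix j assume j: "j < length y"
      obtain i c a where q: "y ! j = ((i, c), a)" by (metis prod.exhaust)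
      have "map ?proj y ! j = zip u v ! j" by (simp only: y(3))
      then have "(i, a) = (u ! j, v ! j)" using q j ly len by simp
      then show "y ! j = zip (zip u ?f) v ! j" using q j ly len by simp
    qed (simp add: ly len)
    moreover have "set ?f \<subseteq> {1..m}" using y(1) unfolding set_L by fastforce
    ultimately have "?f \<in> ?F" using y(2) ly by simp
    then show "y \<in> (\<lambda>f. zip (zip u f) v) ` ?F"
      by (rule image_eqI[rotated]) fact
  next
    fix y assume "y \<in> (\<lambda>f. zip (zip u f) v) ` ?F"
    then obtain f where f: "y = zip (zip u f) v" "length f = length u" "set f \<subseteq> {1..m}" "pack y = x" by auto
    have "map ?proj y = zip u v"
      using f(2) len by (intro nth_equalityI) (simp_all add: f(1))
    moreover have "set y \<subseteq> set ?L"
    proof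
      fix q assume "q \<in> set y"
      then obtain j where j: "j < length u" "q = ((u ! j, f ! j), v ! j)"
        using f(2) len by (auto simp: f(1) set_zip)
      moreover have "f ! j \<in> {1..m}" using f(2,3) j(1) by (metis nth_mem subsetD)
      moreover have "u ! j \<in> {1..wmax u}" using nth_packed[OF u j(1)] by simp
      moreover have "v ! j \<in> block_values u v (u ! j)" using j(1) by (auto simp: block_values_def)
      ultimately show "q \<in> set ?L" unfolding set_L by simp
    qed
    ultimately show "y \<in> ?Y" using f(4) z(2) by simp
  qed
  moreover have "inj_on (\<lambda>f. zip (zip u f) v) ?F"
  proof (rule inj_onI)
    fix f f' assume f: "f \<in> ?F" "f' \<in> ?F" "zip (zip u f) v = zip (zip u f') v"
    then have "length f = length u" "length f' = length u" by simp_all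
    moreover have "map snd (map fst (zip (zip u f) v)) = map snd (map fst (zip (zip u f') v))"
      by (simp only: f(3))
    ultimately show "f = f'" using len by (simp del: map_map)
  qed
  ultimately have "of_nat (card ?F) = (subset_series (map ?proj ?L) z :: 'a)"
    using card_pack_eq[OF L x z(1), of ?proj] by (simp only: card_image)
  also have "map ?proj ?L = concat (map (block_alphabet u v m) [1..<Suc (wmax u)])"
    by (simp add: map_concat o_def block_alphabet_def[abs_def] map_replicate_const del: upt_Suc)
  finally show ?thesis .
qed

text \<open>Only coarsenings of \<open>x\<close> contribute, and they are indexed by the run
  decompositions of \<open>z\<close>. The Goldberg product becomes a coefficient of a product of
  exponentials and \<open>basis_K\<close> supplies \<open>log_weight\<close>, so the sum is a
  substitution of the logarithm.\<close>

lemma sum_lookup_basis_K: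
  assumes u: "packed u" and len: "length v = length u" and x: "packed x" "finer x u"
    and z: "length z = wmax x" "pull z x = zip u v"
  shows "(\<Sum>w\<in>W_set u v.
      (\<Prod>i=1..wmax u. poly (goldberg (refinement_word (restrict_word u i v) (restrict_word u i w))) (of_nat m)) *
      Poly_Mapping.lookup (basis_K w) x) =
    (subset_series (concat (map (block_alphabet u v m) [1..<Suc (wmax u)])) z :: 'a::field_char_0)"
proof -
  let ?G = "\<lambda>w. \<Prod>i=1..wmax u. poly (goldberg (refinement_word (restrict_word u i v) (restrict_word u i w))) (of_nat m) :: 'a"
  let ?K = "\<lambda>w. Poly_Mapping.lookup (basis_K w) x :: 'a"
  let ?L = "concat (map (block_alphabet u v m) [1..<Suc (wmax u)])"
  let ?w = "\<lambda>bs. pull (run_labels bs) x"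
  have bij: "bij_betw ?w (run_decomps z) {w \<in> W_set u v. finer x w}"
    by (rule bij_betw_run_decomps[OF x z len[symmetric]])
  have "(\<Sum>w\<in>W_set u v. ?G w * ?K w) = (\<Sum>w\<in>{w \<in> W_set u v. finer x w}. ?G w * ?K w)"
    by (rule sum.mono_neutral_right) (auto simp: finite_W dest: finer_of_lookup_basis_K)
  also have "\<dots> = (\<Sum>bs\<in>run_decomps z. ?G (?w bs) * ?K (?w bs))"
    by (rule sum.reindex_bij_betw[OF bij, symmetric])
  also have "\<dots> = (\<Sum>bs\<in>run_decomps z. prod_series (\<lambda>k. 1 / fact k) ?L (map fst bs) * log_weight bs)"
  proof (intro sum.cong refl arg_cong2[of _ _ _ _ "(*)"])
    fix bs assume bs: "bs \<in> run_decomps z"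
    show "?K (?w bs) = log_weight bs" by (rule lookup_basis_K_run_labels[OF x(1) bs z(1)])
    have pos: "\<forall>q\<in>set bs. 0 < snd q" and ex: "expand bs = z" using bs by (auto simp: run_decomps_def)
    have ll: "length (run_labels bs) = wmax x"
      using ex z(1) pull_run_labels[of bs] length_pull[of "map fst bs" "run_labels bs"] by simp
    show "?G (?w bs) = prod_series (\<lambda>k. 1 / fact k) ?L (map fst bs)"
    proof (rule prod_poly_goldberg_restrict[OF u _ len])
      show "?w bs \<in> W_set u v" using bij bs by (auto simp: bij_betw_def)
      show "length (map fst bs) = wmax (?w bs)"
        using packed_wmax(2)[OF trans[OF set_pull[OF x(1) ll] set_run_labels[OF pos]]] by simp
      show "pull (map fst bs) (?w bs) = zip u v"
        unfolding pull_pull[OF x(1) ll] pull_run_labels ex by (rule z(2))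
    qed
  qed
  also have "\<dots> = log_subst (prod_series (\<lambda>k. 1 / fact k) ?L) z"
    by (simp only: log_subst_def)
  also have "\<dots> = subset_series ?L z"
    by (rule log_subst_prod_series)
  finally show ?thesis .
qed

section \<open>Comparison of coefficients at natural values of \<open>t\<close>\<close>

theorem mainTheorem7:
  fixes u v :: "nat list" and n :: nat
  assumes "packed u" and "packed v" and "length u = n" and "length v = n"
  shows "(basis_N u :: nat list \<Rightarrow>\<^sub>0 'a::field_char_0 poly) \<star> sigma n \<star> basis_N v =
    (\<Sum>w\<in>W_set u v.
       scale (\<Prod>i=1..wmax u. goldberg (refinement_word (restrict_word u i v) (restrict_word u i w)))
         (extend_scalars (basis_K w)))"
proof (rule poly_mapping_eqI, rule poly_eqI_of_nat)
  fix x and m :: nat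
  let ?G = "\<lambda>w. \<Prod>i=1..wmax u. goldberg (refinement_word (restrict_word u i v) (restrict_word u i w)) :: 'a poly"
  let ?K = "\<lambda>w. Poly_Mapping.lookup (basis_K w) x :: 'a"
  let ?lhs = "Poly_Mapping.lookup (basis_N u \<star> sigma n \<star> basis_N v) x :: 'a poly"
  let ?rhs = "Poly_Mapping.lookup (\<Sum>w\<in>W_set u v. scale (?G w) (extend_scalars (basis_K w))) x"
  let ?F = "{f. length f = length u \<and> set f \<subseteq> {1..m} \<and> pack (zip (zip u f) v) = x}"
  have len: "length v = length u" using assms by simp
  have lhs: "poly ?lhs (of_nat m) = of_nat (card ?F)"
    using poly_lookup_N_sigma_N[OF len, of x m] assms(3) by simp
  have "Poly_Mapping.lookup (extend_scalars (basis_K w)) x = [:?K w:]" for w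
    by (simp add: extend_scalars_def map.rep_eq when_def)
  then have rhs: "poly ?rhs (of_nat m) = (\<Sum>w\<in>W_set u v. (\<Prod>i=1..wmax u.
      poly (goldberg (refinement_word (restrict_word u i v) (restrict_word u i w))) (of_nat m)) * ?K w)"
    by (simp add: lookup_sum poly_sum poly_prod mult.commute)
  show "poly ?lhs (of_nat m) = poly ?rhs (of_nat m)"
  \<comment> \<open>In the first case the pairs of letters of \<open>u\<close> and \<open>v\<close>
    are constant on the blocks of \<open>x\<close>, so \<open>z\<close> exists; in the second both
    sides vanish.\<close>
  proof (cases "packed x \<and> finer x u \<and> weakly_finer x v")
    case True
    then have x: "packed x" "finer x u" "weakly_finer x v" by auto
    then have lx: "length x = length u" by (simp add: finer_def)
    have eq: "zip u v ! i = zip u v ! j" if "i < length x" "j < length x" "x ! i = x ! j" for i j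
    proof -
      have "u ! i = u ! j" using x(2) lx that unfolding finer_def by (metis order.antisym order.refl)
      moreover have "v ! i = v ! j" using x(3) lx len that unfolding weakly_finer_def by metis
      ultimately show ?thesis using that lx len by simp
    qed
    have "length (zip u v) = length x" using lx len by simp
    then obtain z where z: "length z = wmax x" "pull z x = zip u v"
      using exists_pull[OF x(1) _ eq] by blast
    show ?thesis
      unfolding lhs rhs sum_lookup_basis_K[OF assms(1) len x(1,2) z]
      by (rule card_words_zip_pack_eq[OF assms(1) len x(1) z])
  next
    case False
    have F: "?F = {}"
    proof (rule equals0I)
      fix f assume "f \<in> ?F"
      then have f: "length f = length u" "x = pack (zip (zip u f) v)" by auto
      have le: "u ! i < u ! j \<or> (u ! i = u ! j \<and> (f ! i < f ! j \<or> f ! i = f ! j \<and> v ! i \<le> v ! j))"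
        if "x ! i \<le> x ! j" "i < length u" "j < length u" for i j
      proof -
        have "((u ! i, f ! i), v ! i) \<le> ((u ! j, f ! j), v ! j)"
          using that f(1) len unfolding f(2) by (simp add: pack_le_iff del: less_eq_prod_simp)
        then show ?thesis by (auto simp: not_less_iff_gr_or_eq)
      qed
      have lx: "length x = length u" using f len by simp
      have "finer x u" unfolding finer_def using le lx by fastforce
      moreover have "weakly_finer x v"
        unfolding weakly_finer_def
      proof (intro conjI allI impI)
        fix i j assume ij: "i < length v" "j < length v" "x ! i = x ! j"
        \<comment> \<open>Both comparisons hold, so the two triples are equal.\<close>
        then show "v ! i = v ! j" using le[of i j] le[of j i] len by auto
      qed (use lx len in simp)
      ultimately show False using False f(2) packed_pack by blast
    qed
    moreover have "?K w = 0" if "w \<in> W_set u v" for w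
    proof (rule ccontr)
      assume "?K w \<noteq> 0"
      note xw = finer_of_lookup_basis_K[OF this]
      have w: "length w = length u" "finer w u" "weakly_finer w v" using that by (auto simp: W_set_def)
      have "finer x u" using xw(2) w(1,2) by (simp add: finer_def)
      moreover have "weakly_finer x v"
        using xw(2) w(1,3) len unfolding finer_def weakly_finer_def by (metis order.antisym order.refl)
      ultimately show False using False xw(1) by blast
    qed
    ultimately show ?thesis unfolding lhs rhs F by simp
  qed
qed

end
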